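(* Let $(X,\mu,H,\Pi,\mathcal{M}_0,A)$ be as in the Abstract Setting. Assume that (i) $A$ contains a nonconstant function $f_0$, and (ii) every measure in $\mathcal{M}_0$ is absolutely continuous with respect to $\mu$. Then $\Pi$ cannot be extended to a bounded linear operator on $L^1(X,\mu)$, i.e. there is no $C<\infty$ with $\|\Pi f\|_{L^1(X,\mu)}\le C\|f\|_{L^1(X,\mu)}$ for all $f\in L^2(X,\mu)$.
   Context: Abstract Setting: $X$ is a compact connected Hausdorff space; $\mu$ is a finite regular Borel measure on $X$ of full support ($\mu(V)>0$ for every nonempty open $V$). $C(X)$ is the algebra of continuous complex functions with sup norm; $\mathcal{M}(X)$ is the space of regular complex Borel measures on $X$, identified with the dual of $C(X)$, with its weak-$*$ topology; $L^1(X,\mu)$ is viewed inside $\mathcal{M}(X)$ via $f\mapsto f\,d\mu$. $H$ is a closed linear subspace of $L^2(X,\mu)$ and $\Pi:L^2(X,\mu)\to H$ is the orthogonal projection. $\mathcal{M}_0\subseteq\mathcal{M}(X)$ is the weak-$*$ closure of $H$ (viewed in $\mathcal{M}(X)$). $A\subseteq C(X)\cap H$ is a linear subspace containing the constants and closed under pointwise multiplication (not necessarily closed in sup norm). *)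

theory Defs
  imports "HOL-Analysis.Analysis"
begin

text \<open>The space X is the universe of a type 'a. A Borel measure is a measure on 'a
  whose sigma-algebra is the Borel sigma-algebra.\<close>

definition borel_on :: "'a::topological_space measure \<Rightarrow> bool" where
  "borel_on M \<longleftrightarrow> sets M = sets borel"

definition regular_measure :: "'a::topological_space measure \<Rightarrow> bool" where
  "regular_measure M \<longleftrightarrow>
     (\<forall>E\<in>sets borel.
        emeasure M E = (INF U\<in>{U. open U \<and> E \<subseteq> U}. emeasure M U) \<and>
        emeasure M E = (SUP K\<in>{K. compact K \<and> K \<subseteq> E}. emeasure M K))"

definition finite_regular_borel :: "'a::topological_space measure \<Rightarrow> bool" where
  "finite_regular_borel M \<longleftrightarrow> borel_on M \<and> emeasure M UNIV < \<infinity> \<and> regular_measure M"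

definition full_support :: "'a::topological_space measure \<Rightarrow> bool" where
  "full_support M \<longleftrightarrow> (\<forall>V. open V \<and> V \<noteq> {} \<longrightarrow> emeasure M V > 0)"

text \<open>Square-integrable complex functions (representatives of elements of L^2).\<close>
definition L2 :: "'a measure \<Rightarrow> ('a \<Rightarrow> complex) set" where
  "L2 M = {f. f \<in> borel_measurable M \<and> integrable M (\<lambda>x. (cmod (f x))\<^sup>2)}"

definition L2_inner :: "'a measure \<Rightarrow> ('a \<Rightarrow> complex) \<Rightarrow> ('a \<Rightarrow> complex) \<Rightarrow> complex" where
  "L2_inner M f g = (\<integral>x. f x * cnj (g x) \<partial>M)"

definition L2_norm :: "'a measure \<Rightarrow> ('a \<Rightarrow> complex) \<Rightarrow> real" where
  "L2_norm M f = sqrt (\<integral>x. (cmod (f x))\<^sup>2 \<partial>M)"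

definition L1_norm :: "'a measure \<Rightarrow> ('a \<Rightarrow> complex) \<Rightarrow> real" where
  "L1_norm M f = (\<integral>x. cmod (f x) \<partial>M)"

text \<open>H is a closed linear subspace of L^2(M), given as a set of representatives
  that is saturated under a.e. equality.\<close>
definition closed_L2_subspace :: "'a measure \<Rightarrow> ('a \<Rightarrow> complex) set \<Rightarrow> bool" where
  "closed_L2_subspace M H \<longleftrightarrow>
     H \<subseteq> L2 M \<and>
     (\<lambda>x. 0) \<in> H \<and>
     (\<forall>f\<in>H. \<forall>g\<in>H. (\<lambda>x. f x + g x) \<in> H) \<and>
     (\<forall>c. \<forall>f\<in>H. (\<lambda>x. c * f x) \<in> H) \<and>
     (\<forall>f\<in>H. \<forall>g\<in>L2 M. (AE x in M. f x = g x) \<longrightarrow> g \<in> H) \<and>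
     (\<forall>h g. (\<forall>n. h n \<in> H) \<and> g \<in> L2 M \<and>
            (\<lambda>n. L2_norm M (\<lambda>x. h n x - g x)) \<longlonglongrightarrow> 0 \<longrightarrow> g \<in> H)"

definition is_orth_proj ::
  "'a measure \<Rightarrow> ('a \<Rightarrow> complex) set \<Rightarrow> (('a \<Rightarrow> complex) \<Rightarrow> ('a \<Rightarrow> complex)) \<Rightarrow> bool" where
  "is_orth_proj M H P \<longleftrightarrow>
     (\<forall>f\<in>L2 M. P f \<in> H \<and> (\<forall>h\<in>H. L2_inner M (\<lambda>x. f x - P f x) h = 0))"

text \<open>Regular complex Borel measures on X, represented in polar form
  nu(E) = integral over E of k d lambda, with lambda a finite regular Borel measure
  and k a bounded Borel function (every regular complex Borel measure has this form,
  e.g. with lambda = |nu|).\<close>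
definition cmeas_rep :: "'a::topological_space measure \<Rightarrow> ('a \<Rightarrow> complex) \<Rightarrow> bool" where
  "cmeas_rep lam k \<longleftrightarrow> finite_regular_borel lam \<and> k \<in> borel_measurable borel \<and>
     (\<exists>B. \<forall>x. cmod (k x) \<le> B)"

definition cmeas_val :: "'a measure \<Rightarrow> ('a \<Rightarrow> complex) \<Rightarrow> 'a set \<Rightarrow> complex" where
  "cmeas_val lam k E = (\<integral>x. indicator E x * k x \<partial>lam)"

definition cmeas_integral :: "'a measure \<Rightarrow> ('a \<Rightarrow> complex) \<Rightarrow> ('a \<Rightarrow> complex) \<Rightarrow> complex" where
  "cmeas_integral lam k g = (\<integral>x. g x * k x \<partial>lam)"

text \<open>Membership of the complex measure (lam,k) in the weak-* closure M_0 of H,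
  where h in H is viewed as the measure h d mu: every basic weak-* neighbourhood
  of the measure meets H.\<close>
definition in_wstar_closure ::
  "'a::topological_space measure \<Rightarrow> ('a \<Rightarrow> complex) set \<Rightarrow> 'a measure \<Rightarrow> ('a \<Rightarrow> complex) \<Rightarrow> bool" where
  "in_wstar_closure M H lam k \<longleftrightarrow>
     (\<forall>G \<epsilon>. finite G \<and> (\<forall>g\<in>G. continuous_on UNIV g) \<and> \<epsilon> > 0 \<longrightarrow>
        (\<exists>h\<in>H. \<forall>g\<in>G. cmod (cmeas_integral lam k g - (\<integral>x. g x * h x \<partial>M)) < \<epsilon>))"

definition cmeas_abs_cont :: "'a::topological_space measure \<Rightarrow> 'a measure \<Rightarrow> ('a \<Rightarrow> complex) \<Rightarrow> bool" where
  "cmeas_abs_cont M lam k \<longleftrightarrow>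
     (\<forall>E\<in>sets borel. emeasure M E = 0 \<longrightarrow> cmeas_val lam k E = 0)"

end

theory Submission
  imports Defs
begin

text \<open>Suppose \<open>P\<close> is bounded in the L1 norm. A set \<open>E\<close> on which some function \<open>h\<close> of the uniform closure
  of \<open>A\<close> peaks (\<open>h = 1\<close> on \<open>E\<close>, \<open>\<bar>h\<bar> < 1\<close> elsewhere) must have positive measure: the projections of
  normalised indicators of neighbourhoods of \<open>E\<close> are bounded in L1, and a weak-* limit of them
  charges \<open>E\<close>, although by hypothesis it is absolutely continuous.

  On the other hand there are uncountably many disjoint peak sets. If the real part of \<open>f \<in> A\<close> is not
  constant, then by connectedness it takes all values \<open>t\<close> in an interval; let \<open>z\<close> be the lowest
  value of \<open>f\<close> on the line \<open>Re z = t\<close>. The vertical ray below \<open>z\<close> misses the range of \<open>f\<close>, so a branch of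
  the square root of \<open>- i (f - z)\<close> lies in the closed algebra generated by \<open>f\<close>, and
  \<open>exp (- csqrt (- i (f - z)))\<close> peaks exactly where \<open>f = z\<close>.\<close>

section \<open>Riesz representation on compact Hausdorff spaces\<close>

text \<open>The final contradiction is a count of atoms: the distribution of \<open>Re f\<close>
  under \<open>M\<close> is a finite measure on the line, so only countably many single points carry
  mass, whereas every \<open>t\<close> in an interval would have to. Since \<open>X\<close> need not
  be metrizable, bounded sequences of measures may lack weak-* convergent subsequences; hence the
  filter limits. Such a limit is at first only a functional, and absolute continuity can be applied
  to it only after the Riesz theorem has made it a measure. The peak functions are merely uniform
  limits of elements of \<open>A\<close>; they stay in \<open>H\<close> because uniform convergence
  on a finite measure space implies L2 convergence. Their powers are then orthogonal to
  \<open>f - P f\<close>, which is the origin of the conjugates in the test functions. The square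
  root is essential for peaking: the range of \<open>f\<close> may approach \<open>z\<close> from
  every direction except straight down, and only after the slit plane is opened to a half plane does
  \<open>exp (- s)\<close> have modulus below \<open>1\<close> on it. The branch point itself lies
  in the image, so roots are first built for functions shifted away from it.\<close>

lemma Urysohn_compact:
  fixes S T :: "'a::t2_space set"
  assumes "compact (UNIV :: 'a set)" "closed S" "closed T" "S \<inter> T = {}"
  obtains g :: "'a \<Rightarrow> real" where "continuous_on UNIV g" "\<And>x. 0 \<le> g x" "\<And>x. g x \<le> 1"
    "\<And>x. x \<in> S \<Longrightarrow> g x = 1" "\<And>x. x \<in> T \<Longrightarrow> g x = 0"
proof -
  have "Hausdorff_space (euclidean :: 'a topology)"
    unfolding Hausdorff_space_def disjnt_def using hausdorff by auto
  moreover have "compact_space (euclidean :: 'a topology)"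
    using assms(1) by (simp add: compact_space_def)
  ultimately have "normal_space (euclidean :: 'a topology)"
    by (simp add: compact_Hausdorff_or_regular_imp_normal_space)
  from Urysohn_lemma[OF this, of T S 0 1] assms
  obtain f :: "'a \<Rightarrow> real" where f: "continuous_map euclidean (top_of_set {0..1}) f"
      "f ` T \<subseteq> {0}" "f ` S \<subseteq> {1}"
    by (auto simp: disjnt_def)
  from f(1) have "continuous_on UNIV f" "range f \<subseteq> {0..1}"
    by (auto simp: continuous_map_in_subtopology)
  then show ?thesis
    using f(2,3) by (intro that[of f]) (auto simp: image_subset_iff)
qed

section \<open>Positive functionals and the outer measure they induce\<close>

locale positive_functional =
  fixes L :: "('a::t2_space \<Rightarrow> real) \<Rightarrow> real"
  assumes compact_UNIV: "compact (UNIV :: 'a set)"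
    and add: "\<And>u v. continuous_on UNIV u \<Longrightarrow> continuous_on UNIV v \<Longrightarrow> L (\<lambda>x. u x + v x) = L u + L v"
    and scale: "\<And>c u. continuous_on UNIV u \<Longrightarrow> L (\<lambda>x. c * u x) = c * L u"
    and nonneg: "\<And>u. continuous_on UNIV u \<Longrightarrow> (\<And>x. 0 \<le> u x) \<Longrightarrow> 0 \<le> L u"
begin

lemma diff:
  assumes "continuous_on UNIV u" "continuous_on UNIV v"
  shows "L (\<lambda>x. u x - v x) = L u - L v"
  using add[of u "\<lambda>x. - 1 * v x"] scale[of v "- 1"] assms by (simp add: continuous_on_minus)

lemma mono:
  assumes "continuous_on UNIV u" "continuous_on UNIV v" "\<And>x. u x \<le> v x"
  shows "L u \<le> L v"
proof -
  have "0 \<le> L (\<lambda>x. v x - u x)"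
    using assms by (intro nonneg continuous_intros) auto
  with diff[of v u] assms show ?thesis by simp
qed

lemma const: "L (\<lambda>x. c) = c * L (\<lambda>x. 1)"
  using scale[of "\<lambda>x. 1" c] by simp

lemma zero: "L (\<lambda>x. 0) = 0"
  using const[of 0] by simp

lemma sum:
  assumes "finite I" "\<And>i. i \<in> I \<Longrightarrow> continuous_on UNIV (u i)"
  shows "L (\<lambda>x. \<Sum>i\<in>I. u i x) = (\<Sum>i\<in>I. L (u i))"
  using assms
proof (induction I rule: finite_induct)
  case empty
  then show ?case by (simp add: zero)
next
  case (insert i I)
  then show ?case
    using add[of "u i" "\<lambda>x. \<Sum>i\<in>I. u i x"] by (simp add: continuous_on_sum)
qed

text \<open>These are the test functions of the Riesz-Markov-Kakutani construction. Instead of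
  support inside \<open>U\<close>, only vanishing outside \<open>U\<close> is demanded;
  \<open>dominated_truncate\<close> recovers a closed set inside \<open>U\<close> whenever one is
  wanted.\<close>

definition dominated :: "'a set \<Rightarrow> ('a \<Rightarrow> real) set" where
  "dominated U = {u. continuous_on UNIV u \<and> (\<forall>x. 0 \<le> u x \<and> u x \<le> indicator U x)}"

definition open_val :: "'a set \<Rightarrow> ennreal" where
  "open_val U = (SUP u\<in>dominated U. ennreal (L u))"

definition outer_val :: "'a set \<Rightarrow> ennreal" where
  "outer_val E = (INF U\<in>{U. open U \<and> E \<subseteq> U}. open_val U)"

lemma dominatedD:
  assumes "u \<in> dominated U"
  shows "continuous_on UNIV u" "0 \<le> u x" "u x \<le> 1" "x \<notin> U \<Longrightarrow> u x = 0"
proof -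
  have u: "continuous_on UNIV u" "\<And>x. 0 \<le> u x" "\<And>x. u x \<le> indicator U x"
    using assms by (auto simp: dominated_def)
  show "continuous_on UNIV u" "0 \<le> u x" by (fact u)+
  show "u x \<le> 1" using u(3)[of x] indicator_le_1[of U x, where 'a=real] by linarith
  show "u x = 0" if "x \<notin> U" using u(2,3)[of x] that by auto
qed

lemma dominatedI:
  assumes "continuous_on UNIV u" "\<And>x. 0 \<le> u x" "\<And>x. u x \<le> 1" "\<And>x. x \<notin> U \<Longrightarrow> u x = 0"
  shows "u \<in> dominated U"
  using assms by (auto simp: dominated_def indicator_def)

lemma dominated_nonneg: "u \<in> dominated U \<Longrightarrow> 0 \<le> L u"
  using dominatedD(1,2) by (intro nonneg)

lemma zero_dominated: "(\<lambda>x. 0) \<in> dominated U"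
  by (auto simp: dominated_def)

lemma open_val_upper: "u \<in> dominated U \<Longrightarrow> ennreal (L u) \<le> open_val U"
  unfolding open_val_def by (rule SUP_upper)

lemma open_val_mono: "U \<subseteq> V \<Longrightarrow> open_val U \<le> open_val V"
  unfolding open_val_def
  by (intro SUP_subset_mono order_refl subsetI dominatedI)
     (auto simp: dominatedD(1-3) intro: dominatedD(4))

lemma open_val_empty: "open_val {} = 0"
proof -
  have "L u = 0" if "u \<in> dominated {}" for u
  proof -
    have "u = (\<lambda>x. 0)" using dominatedD(4)[OF that] by auto
    then show ?thesis by (simp add: zero)
  qed
  then show ?thesis
    unfolding open_val_def using zero_dominated[of "{}"] by (intro SUP_eq_const) auto
qed

lemma open_val_UNIV: "open_val UNIV = ennreal (L (\<lambda>x. 1))"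
proof (rule antisym)
  show "open_val UNIV \<le> ennreal (L (\<lambda>x. 1))"
    unfolding open_val_def
    by (intro SUP_least ennreal_leI mono) (auto simp: dominatedD(1,3))
  show "ennreal (L (\<lambda>x. 1)) \<le> open_val UNIV"
    by (intro open_val_upper dominatedI) auto
qed

lemma L_one_nonneg: "0 \<le> L (\<lambda>x. 1)"
  by (rule nonneg) auto

text \<open>Lowering \<open>u\<close> by \<open>e\<close> and cutting at zero pushes the nonzero set
  into the closed set where \<open>e \<le> u\<close>, which lies in \<open>U\<close>. The price is
  at most \<open>e\<close> times the total mass.\<close>

lemma dominated_truncate:
  assumes "u \<in> dominated U" "0 < e"
  obtains v K where "v \<in> dominated U" "closed K" "K \<subseteq> U" "\<And>x. x \<notin> K \<Longrightarrow> v x = 0"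
    "L u \<le> L v + e * L (\<lambda>x. 1)"
proof
  note u = dominatedD[OF assms(1)]
  let ?v = "\<lambda>x. max (u x - e) 0"
  let ?K = "{x. e \<le> u x}"
  have c: "continuous_on UNIV ?v"
    using u(1) by (intro continuous_intros)
  show "?v \<in> dominated U"
  proof (rule dominatedI[OF c])
    fix x
    show "0 \<le> ?v x" "?v x \<le> 1" "x \<notin> U \<Longrightarrow> ?v x = 0"
      using u(3)[of x] u(4)[of x] assms(2) by auto
  qed
  show "closed ?K"
    using u(1) by (intro closed_Collect_le continuous_intros)
  show "?K \<subseteq> U"
    using u(4) assms(2) by force
  show "\<And>x. x \<notin> ?K \<Longrightarrow> ?v x = 0"
    by auto
  have "L u \<le> L (\<lambda>x. ?v x + e)"
    using u(1) c by (intro mono continuous_intros) auto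
  also have "\<dots> = L ?v + e * L (\<lambda>x. 1)"
    using add[OF c, of "\<lambda>x. e"] const[of e] by simp
  finally show "L u \<le> L ?v + e * L (\<lambda>x. 1)" .
qed

text \<open>Truncation errors come as multiples of \<open>L (\<lambda>x. 1)\<close>; this turns them
  into arbitrary positive errors.\<close>

lemma le_approx:
  assumes "\<And>e. 0 < e \<Longrightarrow> a \<le> b + ennreal (e * L (\<lambda>x. 1))"
  shows "a \<le> b"
proof (rule ennreal_le_epsilon)
  fix e :: real assume e: "0 < e"
  \<comment> \<open>The summand \<open>1\<close> keeps the denominator positive when the total mass
    is zero.\<close>
  let ?d = "e / (L (\<lambda>x. 1) + 1)"
  have "?d > 0" using e L_one_nonneg by simp
  have "?d * L (\<lambda>x. 1) \<le> e"
    using e L_one_nonneg by (simp add: field_simps)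
  then have "b + ennreal (?d * L (\<lambda>x. 1)) \<le> b + ennreal e"
    by (intro add_left_mono ennreal_leI)
  with assms[OF \<open>?d > 0\<close>] show "a \<le> b + ennreal e" by (rule order_trans)
qed

text \<open>A two-piece partition of unity: the Urysohn function \<open>g\<close> is
  \<open>1\<close> on the part of \<open>K\<close> outside \<open>V\<close> and \<open>0\<close>
  outside \<open>U\<close>, so a truncated test function splits into \<open>v * g\<close> living in
  \<open>U\<close> and \<open>v * (1 - g)\<close> living in \<open>V\<close>.\<close>

lemma open_val_Un:
  assumes "open U" "open V"
  shows "open_val (U \<union> V) \<le> open_val U + open_val V"
  unfolding open_val_def[of "U \<union> V"]
proof (rule SUP_least, rule le_approx)
  fix u and e :: real assume u: "u \<in> dominated (U \<union> V)" and e: "0 < e"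
  obtain v K where v: "v \<in> dominated (U \<union> V)" "closed K" "K \<subseteq> U \<union> V" "\<And>x. x \<notin> K \<Longrightarrow> v x = 0"
    "L u \<le> L v + e * L (\<lambda>x. 1)"
    using dominated_truncate[OF u e] by blast
  have "closed (K - V)" "closed (- U)" "(K - V) \<inter> - U = {}"
    using v assms by (auto intro: closed_Diff)
  then obtain g :: "'a \<Rightarrow> real" where g: "continuous_on UNIV g" "\<And>x. 0 \<le> g x" "\<And>x. g x \<le> 1"
    "\<And>x. x \<in> K - V \<Longrightarrow> g x = 1" "\<And>x. x \<in> - U \<Longrightarrow> g x = 0"
    by (rule Urysohn_compact[OF compact_UNIV]) blast
  note v' = dominatedD[OF v(1)]
  have 1: "(\<lambda>x. v x * g x) \<in> dominated U"
  proof (intro dominatedI)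
    show "continuous_on UNIV (\<lambda>x. v x * g x)"
      using g(1) v'(1) by (intro continuous_intros)
    show "0 \<le> v x * g x" "v x * g x \<le> 1" for x
      using g(2,3)[of x] v'(2,3)[of x] by (auto intro: mult_le_one)
    show "v x * g x = 0" if "x \<notin> U" for x
      using that g(5)[of x] by auto
  qed
  have 2: "(\<lambda>x. v x * (1 - g x)) \<in> dominated V"
  proof (intro dominatedI)
    show "continuous_on UNIV (\<lambda>x. v x * (1 - g x))"
      using g(1) v'(1) by (intro continuous_intros)
    show "0 \<le> v x * (1 - g x)" "v x * (1 - g x) \<le> 1" for x
      using g(2,3)[of x] v'(2,3)[of x] by (auto intro: mult_le_one)
    show "v x * (1 - g x) = 0" if "x \<notin> V" for x
      using that g(4)[of x] v(4)[of x] by auto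
  qed
  have "L v = L (\<lambda>x. v x * g x) + L (\<lambda>x. v x * (1 - g x))"
    using add[OF dominatedD(1)[OF 1] dominatedD(1)[OF 2]] by (simp add: algebra_simps)
  then have "ennreal (L u) \<le> ennreal (L (\<lambda>x. v x * g x) + L (\<lambda>x. v x * (1 - g x)) + e * L (\<lambda>x. 1))"
    using v(5) by (intro ennreal_leI) simp
  also have "\<dots> = ennreal (L (\<lambda>x. v x * g x)) + ennreal (L (\<lambda>x. v x * (1 - g x))) + ennreal (e * L (\<lambda>x. 1))"
    using dominated_nonneg[OF 1] dominated_nonneg[OF 2] e L_one_nonneg by (simp add: ennreal_plus)
  also have "\<dots> \<le> open_val U + open_val V + ennreal (e * L (\<lambda>x. 1))"
    by (intro add_mono open_val_upper 1 2 order_refl)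
  finally show "ennreal (L u) \<le> open_val U + open_val V + ennreal (e * L (\<lambda>x. 1))" .
qed

lemma open_val_UN_finite:
  assumes "finite I" "\<And>i. i \<in> I \<Longrightarrow> open (U i)"
  shows "open_val (\<Union>i\<in>I. U i) \<le> (\<Sum>i\<in>I. open_val (U i))"
  using assms
proof (induction I rule: finite_induct)
  case empty
  then show ?case by (simp add: open_val_empty)
next
  case (insert i I)
  have "open_val (\<Union>i\<in>insert i I. U i) \<le> open_val (U i) + open_val (\<Union>i\<in>I. U i)"
    using insert open_val_Un[of "U i" "\<Union>i\<in>I. U i"] by auto
  also have "\<dots> \<le> open_val (U i) + (\<Sum>i\<in>I. open_val (U i))"
    using insert by (intro add_left_mono) auto
  finally show ?case using insert by simp
qed

text \<open>After truncation the test function lives on a compact \<open>K\<close>, which finitely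
  many of the \<open>U i\<close> cover.\<close>

lemma open_val_UN:
  assumes "\<And>i::nat. open (U i)"
  shows "open_val (\<Union>i. U i) \<le> (\<Sum>i. open_val (U i))"
  unfolding open_val_def[of "\<Union>i. U i"]
proof (rule SUP_least, rule le_approx)
  fix u and e :: real assume u: "u \<in> dominated (\<Union>i. U i)" and e: "0 < e"
  obtain v K where v: "v \<in> dominated (\<Union>i. U i)" "closed K" "K \<subseteq> (\<Union>i. U i)"
    "\<And>x. x \<notin> K \<Longrightarrow> v x = 0" "L u \<le> L v + e * L (\<lambda>x. 1)"
    using dominated_truncate[OF u e] by blast
  have "compact K"
    using compact_Int_closed[OF compact_UNIV v(2)] by simp
  then obtain I where I: "finite I" "K \<subseteq> (\<Union>i\<in>I. U i)"
    using compactE_image[of K UNIV U] assms v(3) by metis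
  have "v \<in> dominated (\<Union>i\<in>I. U i)"
    using v(4) I(2) by (intro dominatedI dominatedD(1-3)[OF v(1)]) auto
  then have "ennreal (L v) \<le> open_val (\<Union>i\<in>I. U i)"
    by (rule open_val_upper)
  also have "\<dots> \<le> (\<Sum>i\<in>I. open_val (U i))"
    using I assms by (intro open_val_UN_finite)
  also have "\<dots> \<le> (\<Sum>i. open_val (U i))"
    using I by (intro sum_le_suminf) auto
  finally have *: "ennreal (L v) \<le> (\<Sum>i. open_val (U i))" .
  have "ennreal (L u) \<le> ennreal (L v + e * L (\<lambda>x. 1))"
    using v(5) by (rule ennreal_leI)
  also have "\<dots> = ennreal (L v) + ennreal (e * L (\<lambda>x. 1))"
    using dominated_nonneg[OF v(1)] e L_one_nonneg by (simp add: ennreal_plus)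
  also have "\<dots> \<le> (\<Sum>i. open_val (U i)) + ennreal (e * L (\<lambda>x. 1))"
    using * by (rule add_right_mono)
  finally show "ennreal (L u) \<le> (\<Sum>i. open_val (U i)) + ennreal (e * L (\<lambda>x. 1))" .
qed

lemma outer_val_open: "open U \<Longrightarrow> outer_val U = open_val U"
  unfolding outer_val_def by (intro antisym INF_greatest INF_lower) (auto intro: open_val_mono)

lemma outer_val_mono: "E \<subseteq> F \<Longrightarrow> outer_val E \<le> outer_val F"
  unfolding outer_val_def by (intro INF_superset_mono) auto

lemma outer_val_finite: "outer_val E < \<infinity>"
proof -
  have "outer_val E \<le> outer_val UNIV" by (rule outer_val_mono) simp
  also have "\<dots> < \<infinity>" by (simp add: outer_val_open open_val_UNIV)
  finally show ?thesis .
qed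

lemma outer_val_approx:
  assumes "0 < e"
  obtains U where "open U" "E \<subseteq> U" "open_val U \<le> outer_val E + ennreal e"
proof -
  have "outer_val E < outer_val E + ennreal e"
    using outer_val_finite[of E] assms ennreal_add_left_cancel_less[of "outer_val E" 0 "ennreal e"]
    by simp
  then obtain U where "open U" "E \<subseteq> U" "open_val U < outer_val E + ennreal e"
    unfolding outer_val_def[of E] by (subst (asm) INF_less_iff) auto
  then show ?thesis using that less_imp_le by blast
qed

lemma outer_val_UN: "outer_val (\<Union>i::nat. E i) \<le> (\<Sum>i. outer_val (E i))"
proof (rule ennreal_le_epsilon)
  fix e :: real assume e: "0 < e"
  have "\<exists>U. open U \<and> E i \<subseteq> U \<and> open_val U \<le> outer_val (E i) + ennreal (e * (1/2)^Suc i)" for i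
  proof -
    have "0 < e * (1/2)^Suc i" using e by simp
    then show ?thesis by (rule outer_val_approx) blast
  qed
  then obtain U where U: "\<And>i. open (U i)" "\<And>i. E i \<subseteq> U i"
      "\<And>i. open_val (U i) \<le> outer_val (E i) + ennreal (e * (1/2)^Suc i)"
    by metis
  have "outer_val (\<Union>i. E i) \<le> open_val (\<Union>i. U i)"
    unfolding outer_val_def using U by (intro INF_lower CollectI conjI open_UN ballI UN_mono) auto
  also have "\<dots> \<le> (\<Sum>i. open_val (U i))"
    using U by (intro open_val_UN)
  also have "\<dots> \<le> (\<Sum>i. outer_val (E i) + ennreal (e * (1/2)^Suc i))"
    using U by (intro suminf_le) auto
  also have "\<dots> = (\<Sum>i. outer_val (E i)) + (\<Sum>i. ennreal (e * (1/2)^Suc i))"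
    by (subst suminf_add) auto
  also have "(\<Sum>i. ennreal (e * (1/2)^Suc i)) = ennreal e"
    using e sums_mult[OF power_half_series, of e]
    by (intro suminf_ennreal_eq) (auto simp: zero_le_mult_iff)
  finally show "outer_val (\<Union>i. E i) \<le> (\<Sum>i. outer_val (E i)) + ennreal e" .
qed

lemma outer_val_empty: "outer_val {} = 0"
  by (simp add: outer_val_open open_val_empty)

lemma outer_val_Un: "outer_val (E \<union> F) \<le> outer_val E + outer_val F"
proof -
  let ?E = "\<lambda>i::nat. if i = 0 then E else if i = 1 then F else {}"
  have "(\<Union>i. ?E i) = E \<union> F"
    by (auto split: if_splits)
  moreover have "(\<Sum>i. outer_val (?E i)) = outer_val E + outer_val F"
    by (subst suminf_finite[of "{0,1}"]) (auto simp: outer_val_empty)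
  ultimately show ?thesis using outer_val_UN[of ?E] by simp
qed

text \<open>This is the hard half of the Caratheodory condition for open test sets. A function
  living on \<open>K\<close> inside \<open>V \<inter> U\<close> and one dominated by
  \<open>V - K\<close> are never nonzero together, so their sum is still dominated by
  \<open>V\<close>; and \<open>V - K\<close> is an open set containing \<open>V - U\<close>.\<close>

lemma open_val_split:
  assumes "open U" "open V"
  shows "open_val (V \<inter> U) + outer_val (V - U) \<le> open_val V"
proof (rule le_approx)
  fix e :: real assume e: "0 < e"
  have "ennreal (L u) + outer_val (V - U) \<le> open_val V + ennreal (e * L (\<lambda>x. 1))"
    if u: "u \<in> dominated (V \<inter> U)" for u
  proof -
    obtain v K where v: "v \<in> dominated (V \<inter> U)" "closed K" "K \<subseteq> V \<inter> U"
      "\<And>x. x \<notin> K \<Longrightarrow> v x = 0" "L u \<le> L v + e * L (\<lambda>x. 1)"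
      using dominated_truncate[OF u e] by blast
    have W: "open (V - K)" using assms v by auto
    have "ennreal (L v) + ennreal (L w) \<le> open_val V" if w: "w \<in> dominated (V - K)" for w
    proof -
      have "(\<lambda>x. v x + w x) \<in> dominated V"
      proof (intro dominatedI continuous_intros dominatedD(1)[OF v(1)] dominatedD(1)[OF w])
        fix x
        show "0 \<le> v x + w x" using dominatedD(2-)[OF v(1), of x] dominatedD(2-)[OF w, of x] by simp
        show "v x + w x \<le> 1"
          using dominatedD(2-)[OF v(1), of x] dominatedD(2-)[OF w, of x] v(4)[of x] by (cases "x \<in> K") auto
        show "v x + w x = 0" if "x \<notin> V"
          using that dominatedD(4)[OF v(1), of x] dominatedD(4)[OF w, of x] by auto
      qed
      from open_val_upper[OF this] show ?thesis
        using add[OF dominatedD(1)[OF v(1)] dominatedD(1)[OF w]]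
          dominated_nonneg[OF v(1)] dominated_nonneg[OF w] by (simp add: ennreal_plus)
    qed
    then have *: "ennreal (L v) + open_val (V - K) \<le> open_val V"
      unfolding open_val_def[of "V - K"] using zero_dominated[of "V - K"]
      by (subst ennreal_SUP_add_right) (auto intro!: SUP_least)
    have "ennreal (L u) + outer_val (V - U) \<le> ennreal (L v + e * L (\<lambda>x. 1)) + open_val (V - K)"
      unfolding outer_val_def using v W by (intro add_mono ennreal_leI INF_lower) auto
    also have "\<dots> = ennreal (L v) + open_val (V - K) + ennreal (e * L (\<lambda>x. 1))"
      using dominated_nonneg[OF v(1)] e L_one_nonneg by (simp add: ennreal_plus ac_simps)
    also have "\<dots> \<le> open_val V + ennreal (e * L (\<lambda>x. 1))"
      using * by (rule add_right_mono)
    finally show ?thesis .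
  qed
  then show "open_val (V \<inter> U) + outer_val (V - U) \<le> open_val V + ennreal (e * L (\<lambda>x. 1))"
    unfolding open_val_def[of "V \<inter> U"] using zero_dominated[of "V \<inter> U"]
    by (subst ennreal_SUP_add_left[symmetric]) (auto intro!: SUP_least)
qed

text \<open>An arbitrary test set \<open>E\<close> is approximated from outside by open sets
  \<open>V\<close>, which reduces the splitting to \<open>open_val_split\<close>.\<close>

lemma open_in_lambda_system:
  assumes "open U"
  shows "U \<in> lambda_system UNIV UNIV outer_val"
proof -
  have "outer_val (U \<inter> E) + outer_val ((UNIV - U) \<inter> E) = outer_val E" for E
  proof (rule antisym)
    have "outer_val E = outer_val ((U \<inter> E) \<union> ((UNIV - U) \<inter> E))"
      by (rule arg_cong[of _ _ outer_val]) auto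
    then show "outer_val E \<le> outer_val (U \<inter> E) + outer_val ((UNIV - U) \<inter> E)"
      using outer_val_Un by simp
    show "outer_val (U \<inter> E) + outer_val ((UNIV - U) \<inter> E) \<le> outer_val E"
      unfolding outer_val_def[of E]
    proof (rule INF_greatest, clarify)
      fix V assume V: "open V" "E \<subseteq> V"
      have "outer_val (U \<inter> E) + outer_val ((UNIV - U) \<inter> E) \<le> outer_val (V \<inter> U) + outer_val (V - U)"
        using V by (intro add_mono outer_val_mono) auto
      also have "\<dots> \<le> open_val V"
        using open_val_split[OF assms V(1)] V assms by (simp add: outer_val_open open_Int)
      finally show "outer_val (U \<inter> E) + outer_val ((UNIV - U) \<inter> E) \<le> open_val V" .
    qed
  qed
  then show ?thesis
    by (simp add: lambda_system_def)
qed

definition riesz_measure :: "'a measure" where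
  "riesz_measure = measure_of UNIV (sets borel) outer_val"

lemma sets_riesz: "sets riesz_measure = sets borel"
  unfolding riesz_measure_def using sets.sets_measure_of_eq[of borel] by simp

lemma space_riesz: "space riesz_measure = UNIV"
  using sets_eq_imp_space_eq[OF sets_riesz] by simp

text \<open>By Caratheodory the \<open>lambda_system\<close> is a sigma-algebra on which
  \<open>outer_val\<close> is a measure, and it contains the open sets, hence all Borel sets. Only
  this gives \<open>measure_of\<close> in \<open>riesz_measure\<close> its intended value.\<close>

lemma emeasure_riesz:
  assumes "E \<in> sets borel"
  shows "emeasure riesz_measure E = outer_val E"
proof -
  interpret P: sigma_algebra UNIV "UNIV :: 'a set set"
    using sigma_algebra_Pow[of "UNIV :: 'a set"] by simp
  have "outer_measure_space UNIV outer_val"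
    unfolding outer_measure_space_def positive_def increasing_def countably_subadditive_def
    using outer_val_empty outer_val_UN outer_val_mono by blast
  then have ms: "measure_space UNIV (lambda_system UNIV UNIV outer_val) outer_val"
    by (rule P.caratheodory_lemma)
  then interpret S: sigma_algebra UNIV "lambda_system UNIV UNIV outer_val"
    by (simp add: measure_space_def)
  have sub: "sets borel \<subseteq> lambda_system UNIV UNIV outer_val"
    unfolding sets_borel using S.sigma_sets_subset[of "Collect open"] open_in_lambda_system by auto
  have "sigma_algebra UNIV (sets borel :: 'a set set)"
    by (metis sets.sigma_algebra_axioms space_borel)
  then have "measure_space UNIV (sets borel) outer_val"
    using measure_down[OF ms] sub by blast
  then show ?thesis
    unfolding riesz_measure_def measure_space_def
    by (intro emeasure_measure_of_sigma assms) auto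
qed

end

section \<open>Layer-cake estimates, regularity and the representation formula\<close>

lemma slice_sum:
  fixes y :: real
  assumes "0 \<le> y" "y \<le> real n * d" "0 \<le> d"
  shows "(\<Sum>k<n. min (max (y - real k * d) 0) d) = y"
proof -
  have "(\<Sum>k<m. min (max (y - real k * d) 0) d) = min y (real m * d)" for m
  proof (induction m)
    case (Suc m)
    then show ?case using assms(1,3) by (auto simp: min_def max_def algebra_simps)
  qed (use assms in simp)
  with assms show ?thesis by simp
qed

text \<open>The slices of height \<open>d\<close> whose bottom lies below \<open>y\<close> overshoot
  \<open>y\<close> by less than one slice.\<close>

lemma slice_indicator_sum:
  fixes y :: real
  assumes "0 \<le> y" "0 < d"
  shows "(\<Sum>k<n. indicator {..<y} (real k * d) * d) \<le> y + d"
proof -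
  \<comment> \<open>The second bound \<open>real n * d\<close> strengthens the induction: if slice
    \<open>n\<close> starts below \<open>y\<close>, it shows that one more \<open>d\<close> still
    stays within \<open>y + d\<close>.\<close>
  have "(\<Sum>k<n. indicator {..<y} (real k * d) * d) \<le> min (y + d) (real n * d)"
  proof (induction n)
    case (Suc n)
    let ?S = "\<Sum>k<n. indicator {..<y} (real k * d) * d"
    have "?S \<le> y + d" "?S \<le> real n * d" using Suc by auto
    moreover have "?S + indicator {..<y} (real n * d) * d \<le> y + d"
      using \<open>?S \<le> y + d\<close> \<open>?S \<le> real n * d\<close>
      by (cases "real n * d < y") auto
    moreover have "indicator {..<y} (real n * d) * d \<le> d"
      using assms by (auto simp: indicator_def)
    ultimately have "?S + indicator {..<y} (real n * d) * d \<le> min (y + d) (real n * d + d)"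
      by simp
    then show ?case by (simp only: sum.lessThan_Suc of_nat_Suc algebra_simps)
  qed (use assms in simp)
  then show ?thesis by simp
qed

context positive_functional
begin

lemma emeasure_riesz_open: "open U \<Longrightarrow> emeasure riesz_measure U = open_val U"
  by (simp add: emeasure_riesz outer_val_open)

lemma finite_riesz: "finite_measure riesz_measure"
  using outer_val_finite[of UNIV] by (intro finite_measureI) (simp add: space_riesz emeasure_riesz less_top)

lemma finite_regular_borel_riesz: "finite_regular_borel riesz_measure"
proof -
  interpret finite_measure riesz_measure by (rule finite_riesz)
  have outer: "emeasure riesz_measure E = (INF U\<in>{U. open U \<and> E \<subseteq> U}. emeasure riesz_measure U)"
    if "E \<in> sets borel" for E
    unfolding emeasure_riesz[OF that] outer_val_def
    by (intro INF_cong refl) (simp add: emeasure_riesz_open)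
  \<comment> \<open>Complements exchange the two regularities: an open \<open>U\<close> containing
    \<open>- E\<close> with small excess leaves the compact set \<open>- U\<close> inside
    \<open>E\<close>, and finiteness of the measure turns the excess into a deficit.\<close>
  have inner: "emeasure riesz_measure E = (SUP K\<in>{K. compact K \<and> K \<subseteq> E}. emeasure riesz_measure K)"
    if E: "E \<in> sets borel" for E
  proof (rule antisym)
    show "(SUP K\<in>{K. compact K \<and> K \<subseteq> E}. emeasure riesz_measure K) \<le> emeasure riesz_measure E"
      using E by (intro SUP_least emeasure_mono) (auto simp: sets_riesz)
    show "emeasure riesz_measure E \<le> (SUP K\<in>{K. compact K \<and> K \<subseteq> E}. emeasure riesz_measure K)"
    proof (rule ennreal_le_epsilon)
      fix e :: real assume e: "0 < e"
      have E': "- E \<in> sets borel" using E by (rule borel_comp)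
      obtain U where U: "open U" "- E \<subseteq> U" "open_val U \<le> outer_val (- E) + ennreal e"
        using outer_val_approx[OF e] by blast
      let ?K = "- U"
      have K: "compact ?K" "?K \<subseteq> E"
        using U compact_Int_closed[OF compact_UNIV, of ?K] by auto
      have [simp]: "E \<in> sets riesz_measure" "?K \<in> sets riesz_measure" "U \<in> sets riesz_measure"
          "- E \<in> sets riesz_measure"
        using E E' U by (auto simp: sets_riesz)
      have *: "measure riesz_measure U \<le> measure riesz_measure (- E) + e"
      proof -
        have "ennreal (measure riesz_measure U) \<le> ennreal (measure riesz_measure (- E) + e)"
          using U(1,3) E' e
          by (simp add: emeasure_eq_measure[symmetric] ennreal_plus emeasure_riesz outer_val_open)
        then show ?thesis using e by (subst (asm) ennreal_le_iff) (auto simp: measure_nonneg)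
      qed
      have "measure riesz_measure (- E) = measure riesz_measure UNIV - measure riesz_measure E"
        "measure riesz_measure ?K = measure riesz_measure UNIV - measure riesz_measure U"
        using finite_measure_compl[of E] finite_measure_compl[of U] by (auto simp: space_riesz Compl_eq_Diff_UNIV)
      with * have "measure riesz_measure E \<le> measure riesz_measure ?K + e" by simp
      then have "emeasure riesz_measure E \<le> emeasure riesz_measure ?K + ennreal e"
        using e by (simp add: emeasure_eq_measure ennreal_plus[symmetric] del: ennreal_plus)
      also have "\<dots> \<le> (SUP K\<in>{K. compact K \<and> K \<subseteq> E}. emeasure riesz_measure K) + ennreal e"
        using K by (intro add_right_mono SUP_upper) auto
      finally show "emeasure riesz_measure E \<le> (SUP K\<in>{K. compact K \<and> K \<subseteq> E}. emeasure riesz_measure K) + ennreal e" .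
    qed
  qed
  have "emeasure riesz_measure UNIV < \<infinity>"
    using outer_val_finite[of UNIV] by (simp add: emeasure_riesz)
  then show ?thesis
    unfolding finite_regular_borel_def borel_on_def regular_measure_def
    using outer inner sets_riesz by blast
qed

lemma integrable_riesz:
  fixes u :: "'a \<Rightarrow> real"
  assumes "continuous_on UNIV u"
  shows "integrable riesz_measure u"
proof -
  interpret finite_measure riesz_measure by (rule finite_riesz)
  have "bounded (range u)"
    using assms compact_UNIV by (intro compact_imp_bounded compact_continuous_image)
  then obtain B where "\<And>x. norm (u x) \<le> B" by (auto simp: bounded_iff)
  moreover have "u \<in> borel_measurable riesz_measure"
    using borel_measurable_continuous_onI[OF assms] measurable_cong_sets[OF sets_riesz refl] by blast
  ultimately show ?thesis by (intro integrable_const_bound[of _ B]) auto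
qed

text \<open>Cut \<open>u\<close> into \<open>n\<close> slices of height \<open>d = 1 / n\<close>. A
  slice divided by \<open>d\<close> is a test function for the open set where \<open>u\<close>
  exceeds the bottom of the slice, and the indicators of these sets, weighted by \<open>d\<close>,
  sum to at most \<open>u + d\<close>. The error \<open>d\<close> times the total mass tends to
  zero.\<close>

lemma L_le_riesz_integral:
  assumes u: "continuous_on UNIV u" "\<And>x. 0 \<le> u x" "\<And>x. u x \<le> 1"
  shows "L u \<le> (\<integral>x. u x \<partial>riesz_measure)"
proof -
  interpret finite_measure riesz_measure by (rule finite_riesz)
  let ?I = "\<integral>x. u x \<partial>riesz_measure" and ?m = "measure riesz_measure UNIV"
  have "L u \<le> ?I + ?m / real n" if n: "0 < n" for n
  proof -
    define d where "d = 1 / real n"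
    have d: "0 < d" "real n * d = 1" using n by (auto simp: d_def)
    let ?s = "\<lambda>k x. min (max (u x - real k * d) 0) d"
    let ?U = "\<lambda>k. {x. real k * d < u x}"
    have cs: "continuous_on UNIV (?s k)" for k
      using u(1) by (intro continuous_intros)
    have oU: "open (?U k)" for k
      using u(1) by (intro open_Collect_less continuous_intros)
    have sU: "?U k \<in> sets riesz_measure" for k
      using oU by (simp add: sets_riesz)
    have slice: "L (?s k) \<le> d * measure riesz_measure (?U k)" for k
    proof -
      have dom: "(\<lambda>x. 1 / d * ?s k x) \<in> dominated (?U k)"
      proof (rule dominatedI)
        show "continuous_on UNIV (\<lambda>x. 1 / d * ?s k x)"
          by (intro continuous_intros cs)
        show "0 \<le> 1 / d * ?s k x" "1 / d * ?s k x \<le> 1" "x \<notin> ?U k \<Longrightarrow> 1 / d * ?s k x = 0" for x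
          using d by (auto simp: field_simps)
      qed
      have "ennreal (L (\<lambda>x. 1 / d * ?s k x)) \<le> ennreal (measure riesz_measure (?U k))"
        using open_val_upper[OF dom] emeasure_riesz_open[OF oU] by (simp add: emeasure_eq_measure)
      then have "1 / d * L (?s k) \<le> measure riesz_measure (?U k)"
        using scale[OF cs, of "1 / d"] by (subst (asm) ennreal_le_iff) (auto simp: measure_nonneg)
      then show ?thesis using d by (simp add: field_simps)
    qed
    have "(\<lambda>x. \<Sum>k<n. ?s k x) = u"
      using slice_sum[of _ n d] u(2,3) d by (intro ext) auto
    then have "L u = (\<Sum>k<n. L (?s k))"
      using sum[of "{..<n}" ?s, OF finite_lessThan cs] by metis
    also have "\<dots> \<le> (\<Sum>k<n. d * measure riesz_measure (?U k))"
      by (intro sum_mono slice)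
    also have "\<dots> = (\<integral>x. (\<Sum>k<n. indicator (?U k) x * d) \<partial>riesz_measure)"
      using sU by (subst Bochner_Integration.integral_sum) (auto simp: mult.commute emeasure_eq_measure)
    also have "\<dots> \<le> (\<integral>x. u x + d \<partial>riesz_measure)"
    proof (rule integral_mono)
      show "integrable riesz_measure (\<lambda>x. \<Sum>k<n. indicator (?U k) x * d)"
        using sU by (intro Bochner_Integration.integrable_sum integrable_mult_left integrable_real_indicator)
          (auto simp: emeasure_eq_measure)
      show "integrable riesz_measure (\<lambda>x. u x + d)"
        using integrable_riesz[OF u(1)] by simp
      show "(\<Sum>k<n. indicator (?U k) x * d) \<le> u x + d" for x
        using slice_indicator_sum[of "u x" d n] u d by (simp add: indicator_def)
    qed
    also have "\<dots> = ?I + d * ?m"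
      using integrable_riesz[OF u(1)] by (simp add: space_riesz)
    finally show ?thesis by (simp add: d_def)
  qed
  then have "\<forall>\<^sub>F n in sequentially. L u \<le> ?I + ?m / real n"
    using eventually_gt_at_top[of 0] by (rule eventually_mono[rotated])
  moreover have "(\<lambda>n. ?I + ?m / real n) \<longlonglongrightarrow> ?I + 0"
    by (intro tendsto_intros lim_const_over_n)
  ultimately show ?thesis
    using tendsto_lowerbound[of "\<lambda>n. ?I + ?m / real n" "?I + 0" sequentially "L u"] by simp
qed

text \<open>One inequality on functions with values in the unit interval is enough: applied to
  \<open>1 - v\<close> it reverses, and every continuous function is an affine image of such a
  \<open>v\<close>.\<close>

theorem riesz_representation:
  assumes "continuous_on UNIV u"
  shows "(\<integral>x. u x \<partial>riesz_measure) = L u"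
proof -
  interpret finite_measure riesz_measure by (rule finite_riesz)
  have one: "(\<integral>x. 1 \<partial>riesz_measure) = L (\<lambda>x. 1)"
    using emeasure_riesz_open[of UNIV] L_one_nonneg
    by (simp add: space_riesz open_val_UNIV measure_def)
  have unit: "(\<integral>x. v x \<partial>riesz_measure) = L v"
    if v: "continuous_on UNIV v" "\<And>x. 0 \<le> v x" "\<And>x. v x \<le> 1" for v
  proof (rule antisym)
    show "L v \<le> (\<integral>x. v x \<partial>riesz_measure)" by (rule L_le_riesz_integral[OF v])
    have "L (\<lambda>x. 1 - v x) \<le> (\<integral>x. 1 - v x \<partial>riesz_measure)"
      using v by (intro L_le_riesz_integral continuous_intros) auto
    also have "\<dots> = L (\<lambda>x. 1) - (\<integral>x. v x \<partial>riesz_measure)"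
      using one integrable_riesz[OF v(1)] by (subst Bochner_Integration.integral_diff) auto
    finally show "(\<integral>x. v x \<partial>riesz_measure) \<le> L v"
      using diff[OF _ v(1), of "\<lambda>x. 1"] by simp
  qed
  have "bounded (range u)"
    using assms compact_UNIV by (intro compact_imp_bounded compact_continuous_image)
  then obtain B where B: "\<And>x. \<bar>u x\<bar> \<le> B" by (auto simp: bounded_iff)
  \<comment> \<open>A strictly positive bound, so that dividing by \<open>2 * b\<close> is
    legitimate also when \<open>u\<close> vanishes.\<close>
  define b where "b = B + 1"
  have b: "0 < b" "\<And>x. \<bar>u x\<bar> \<le> b"
    using abs_ge_zero[of "u undefined"] B[of undefined] by (auto simp: b_def intro: order_trans[OF B])
  let ?v = "\<lambda>x. 1 / (2 * b) * (u x + b)"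
  have v: "continuous_on UNIV ?v" "\<And>x. 0 \<le> ?v x" "\<And>x. ?v x \<le> 1"
  proof -
    show "continuous_on UNIV ?v" using assms by (intro continuous_intros)
    show "0 \<le> ?v x" "?v x \<le> 1" for x
      using b(1) b(2)[of x] by (auto simp: field_simps)
  qed
  have cont: "continuous_on UNIV (\<lambda>x. u x + b)" using assms by (intro continuous_intros)
  have "1 / (2 * b) * ((\<integral>x. u x \<partial>riesz_measure) + b * L (\<lambda>x. 1)) = (\<integral>x. ?v x \<partial>riesz_measure)"
    using integrable_riesz[OF assms] one by (subst integral_mult_right_zero) (simp add: mult.commute)
  also have "\<dots> = 1 / (2 * b) * (L u + b * L (\<lambda>x. 1))"
    using unit[OF v] scale[OF cont, of "1 / (2 * b)"] add[OF assms, of "\<lambda>x. b"] const[of b] by simp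
  finally show ?thesis using b(1) by simp
qed

end

text \<open>Both functionals have the same test functions, so the order passes through the supremum
  over them and then through the infimum over open sets.\<close>

lemma riesz_measure_mono:
  assumes "positive_functional \<Lambda>" "positive_functional \<Theta>"
    and le: "\<And>u. continuous_on UNIV u \<Longrightarrow> (\<And>x. 0 \<le> u x) \<Longrightarrow> \<Lambda> u \<le> \<Theta> u"
    and E: "E \<in> sets borel"
  shows "emeasure (positive_functional.riesz_measure \<Lambda>) E \<le> emeasure (positive_functional.riesz_measure \<Theta>) E"
proof -
  interpret A: positive_functional \<Lambda> by fact
  interpret B: positive_functional \<Theta> by fact
  have "A.open_val U \<le> B.open_val U" for U
    unfolding A.open_val_def B.open_val_def A.dominated_def B.dominated_def
    by (rule SUP_mono) (force intro: ennreal_leI le)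
  then have "A.outer_val E \<le> B.outer_val E"
    unfolding A.outer_val_def B.outer_val_def by (intro INF_mono) auto
  then show ?thesis using E by (simp add: A.emeasure_riesz B.emeasure_riesz)
qed

section \<open>Weak-* limits of bounded densities\<close>

text \<open>By Tychonoff; the refining filter \<open>F\<close> replaces a convergent subnet.\<close>

lemma pointwise_bounded_refine:
  fixes \<phi> :: "nat \<Rightarrow> 'i \<Rightarrow> real"
  assumes "\<And>j. \<exists>B. \<forall>m. \<bar>\<phi> m j\<bar> \<le> B"
  obtains F l where "F \<noteq> bot" "F \<le> sequentially" "\<And>j. ((\<lambda>m. \<phi> m j) \<longlongrightarrow> l j) F"
proof -
  obtain B where B: "\<And>j m. \<bar>\<phi> m j\<bar> \<le> B j" using assms by metis
  let ?K = "PiE UNIV (\<lambda>j. {- B j..B j})"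
  have "compactin (product_topology (\<lambda>i. euclidean) UNIV) ?K"
    by (subst compactin_PiE) auto
  then have "compact ?K" by (simp add: euclidean_product_topology)
  moreover have "\<phi> m \<in> ?K" for m
    using B[of m] by (auto simp: abs_le_iff minus_le_iff)
  moreover have "filtermap \<phi> sequentially \<noteq> bot" by (simp add: filtermap_bot_iff)
  ultimately obtain l where l: "inf (nhds l) (filtermap \<phi> sequentially) \<noteq> bot"
    unfolding compact_filter by (metis (no_types, lifting) always_eventually eventually_filtermap)
  \<comment> \<open>\<open>l\<close> is a cluster point of the sequence in a compact product.
    \<open>F\<close> is generated by the tails and the preimages of neighbourhoods of
    \<open>l\<close>; it is proper because the sequence returns to each neighbourhood beyond every
    index.\<close>
  define F where "F = inf sequentially (filtercomap \<phi> (nhds l))"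
  have "F \<noteq> bot"
  proof
    assume "F = bot"
    then have "eventually (\<lambda>_. False) F" by simp
    then obtain P Q where PQ: "eventually P sequentially" "eventually Q (filtercomap \<phi> (nhds l))"
        "\<And>m. P m \<Longrightarrow> Q m \<Longrightarrow> False"
      unfolding F_def eventually_inf by blast
    from PQ(2) obtain R where R: "eventually R (nhds l)" "\<And>m. R (\<phi> m) \<Longrightarrow> Q m"
      unfolding eventually_filtercomap by blast
    have "eventually (\<lambda>y. \<not> R y) (filtermap \<phi> sequentially)"
      unfolding eventually_filtermap using PQ(1) by eventually_elim (use PQ(3) R(2) in blast)
    with R(1) have "eventually (\<lambda>_. False) (inf (nhds l) (filtermap \<phi> sequentially))"
      unfolding eventually_inf by blast
    with l show False by (simp add: trivial_limit_def)
  qed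
  moreover have "F \<le> sequentially" by (simp add: F_def)
  moreover have "((\<lambda>m. \<phi> m j) \<longlongrightarrow> l j) F" for j
  proof -
    have "filterlim \<phi> (nhds l) F"
      unfolding F_def filterlim_def filtermap_le_iff_le_filtercomap by simp
    moreover have "continuous_on UNIV (\<lambda>f :: 'i \<Rightarrow> real. f j)"
      by (rule continuous_on_product_coordinates)
    ultimately show ?thesis
      using continuous_on_tendsto_compose[of UNIV "\<lambda>f. f j" \<phi> l F] by simp
  qed
  ultimately show ?thesis using that by blast
qed

text \<open>On the set where the Radon-Nikodym derivative \<open>f\<close> exceeds \<open>1\<close>,
  the integral of \<open>f - 1\<close> is the mass under \<open>N\<close> minus the mass under
  \<open>M\<close>. Domination makes this difference zero, so \<open>f\<close> is at most
  \<open>1\<close> almost everywhere.\<close>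

lemma density_bounded_exists:
  assumes "finite_measure M" and sets: "sets N = sets M"
    and le: "\<And>E. E \<in> sets M \<Longrightarrow> emeasure N E \<le> emeasure M E"
  obtains k :: "'a \<Rightarrow> real" where "k \<in> borel_measurable M" "\<And>x. 0 \<le> k x" "\<And>x. k x \<le> 1"
    "N = density M (\<lambda>x. ennreal (k x))"
proof -
  interpret finite_measure M by fact
  have "absolutely_continuous M N"
    unfolding absolutely_continuous_def
  proof
    fix E assume "E \<in> null_sets M"
    then show "E \<in> null_sets N" using le[of E] sets by (auto simp: null_sets_def)
  qed
  from Radon_Nikodym[OF this sets] obtain f where f: "f \<in> borel_measurable M" "density M f = N"
    by blast
  have "AE x in M. f x \<le> 1"
  proof -
    let ?E = "{x \<in> space M. 1 < f x}"
    have E[measurable]: "?E \<in> sets M" using f(1) by measurable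
    have "(\<integral>\<^sup>+ x. f x * indicator ?E x - indicator ?E x \<partial>M)
        = (\<integral>\<^sup>+ x. f x * indicator ?E x \<partial>M) - (\<integral>\<^sup>+ x. indicator ?E x \<partial>M)"
    proof (rule nn_integral_diff)
      show "(\<integral>\<^sup>+ x. indicator ?E x \<partial>M) \<noteq> \<infinity>"
        by (simp add: emeasure_eq_measure)
      show "AE x in M. indicator ?E x \<le> f x * indicator ?E x"
        by (auto simp: indicator_def less_imp_le)
    qed (use f(1) in measurable)
    also have "\<dots> = emeasure N ?E - emeasure M ?E"
      unfolding f(2)[symmetric] using f(1) by (subst emeasure_density) simp_all
    also have "\<dots> = 0"
    proof -
      have "emeasure N ?E < top"
        by (rule order.strict_trans1[OF le[OF E]]) (simp add: emeasure_eq_measure)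
      then show ?thesis using le[OF E] by (simp add: diff_eq_0_iff_ennreal)
    qed
    finally have "AE x in M. f x * indicator ?E x - indicator ?E x = 0"
      using f(1) by (subst (asm) nn_integral_0_iff_AE) auto
    with AE_space[of M] show ?thesis
    proof eventually_elim
      case (elim x)
      show ?case
      proof (rule ccontr)
        assume "\<not> f x \<le> 1"
        with elim show False by (simp add: diff_eq_0_iff_ennreal)
      qed
    qed
  qed
  \<comment> \<open>Clipping at \<open>1\<close> alters the density only on a null set but makes it
    real and bounded at every point; the pointwise bound is what \<open>cmeas_rep\<close> asks of a
    density.\<close>
  then have ae: "AE x in M. f x = ennreal (enn2real (min (f x) 1))"
    by eventually_elim (auto simp: min_def ennreal_enn2real_if top_unique)
  show ?thesis
  proof
    show "(\<lambda>x. enn2real (min (f x) 1)) \<in> borel_measurable M" using f(1) by measurable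
    show "0 \<le> enn2real (min (f x) 1)" for x by simp
    show "enn2real (min (f x) 1) \<le> 1" for x
      using enn2real_mono[of "min (f x) 1" 1] by simp
    show "N = density M (\<lambda>x. ennreal (enn2real (min (f x) 1)))"
      unfolding f(2)[symmetric] using f(1) ae by (intro density_cong) auto
  qed
qed


lemma continuous_bounded_compact:
  fixes u :: "'a::topological_space \<Rightarrow> 'b::real_normed_vector"
  assumes "compact (UNIV :: 'a set)" "continuous_on UNIV u"
  obtains B where "0 \<le> B" "\<And>x. norm (u x) \<le> B"
proof -
  have "bounded (range u)"
    using assms by (intro compact_imp_bounded compact_continuous_image)
  then obtain B where "\<And>x. norm (u x) \<le> B" by (auto simp: bounded_iff)
  moreover from this have "0 \<le> B" using norm_ge_zero order_trans by blast
  ultimately show ?thesis using that by blast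
qed

lemma borel_measurable_continuous_borel_sets:
  fixes u :: "'a::topological_space \<Rightarrow> 'b::topological_space"
  assumes "sets M = sets borel" "continuous_on UNIV u"
  shows "u \<in> borel_measurable M"
  using borel_measurable_continuous_onI[OF assms(2)] measurable_cong_sets[OF assms(1) refl] by blast

lemma integrable_continuous_mult:
  fixes u :: "'a::topological_space \<Rightarrow> 'b::{real_normed_field, second_countable_topology, banach}"
  assumes "compact (UNIV :: 'a set)" "sets M = sets borel" "continuous_on UNIV u" "integrable M p"
  shows "integrable M (\<lambda>x. u x * p x)"
proof -
  obtain B where B: "0 \<le> B" "\<And>x. norm (u x) \<le> B"
    using continuous_bounded_compact[OF assms(1,3)] by blast
  show ?thesis
  proof (rule Bochner_Integration.integrable_bound[of M "\<lambda>x. B * norm (p x)"])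
    show "integrable M (\<lambda>x. B * norm (p x))" using assms(4) by simp
    show "(\<lambda>x. u x * p x) \<in> borel_measurable M"
      using assms(4) borel_measurable_continuous_borel_sets[OF assms(2,3)] by measurable
    show "AE x in M. norm (u x * p x) \<le> norm (B * norm (p x))"
      using B by (simp add: norm_mult mult_right_mono)
  qed
qed

text \<open>Each law holds for integration against \<open>p m\<close> and passes to the limit; the
  two equalities use that limits along a proper filter are unique.\<close>

lemma positive_functional_limit:
  fixes p :: "nat \<Rightarrow> 'a::t2_space \<Rightarrow> real"
  assumes comp: "compact (UNIV :: 'a set)" and sets: "sets M = sets borel"
    and p: "\<And>m. integrable M (p m)" "\<And>m x. 0 \<le> p m x"
    and F: "F \<noteq> bot" "\<And>u. continuous_on UNIV u \<Longrightarrow> ((\<lambda>m. \<integral>x. u x * p m x \<partial>M) \<longlongrightarrow> L u) F"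
  shows "positive_functional L"
proof
  note int = integrable_continuous_mult[OF comp sets _ p(1)]
  fix u v :: "'a \<Rightarrow> real" and c :: real assume u: "continuous_on UNIV u"
  { assume v: "continuous_on UNIV v"
    have "((\<lambda>m. \<integral>x. (u x + v x) * p m x \<partial>M) \<longlongrightarrow> L u + L v) F"
      using tendsto_add[OF F(2)[OF u] F(2)[OF v]] int[OF u] int[OF v]
      by (simp add: distrib_right Bochner_Integration.integral_add)
    moreover have "((\<lambda>m. \<integral>x. (u x + v x) * p m x \<partial>M) \<longlongrightarrow> L (\<lambda>x. u x + v x)) F"
      by (intro F(2) continuous_intros u v)
    ultimately show "L (\<lambda>x. u x + v x) = L u + L v"
      using tendsto_unique[OF F(1)] by blast }
  { have "((\<lambda>m. \<integral>x. (c * u x) * p m x \<partial>M) \<longlongrightarrow> c * L u) F"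
      using tendsto_mult_left[OF F(2)[OF u], of c] by (simp add: mult.assoc)
    moreover have "((\<lambda>m. \<integral>x. (c * u x) * p m x \<partial>M) \<longlongrightarrow> L (\<lambda>x. c * u x)) F"
      by (intro F(2) continuous_intros u)
    ultimately show "L (\<lambda>x. c * u x) = c * L u"
      using tendsto_unique[OF F(1)] by blast }
  { assume "\<And>x. 0 \<le> u x"
    then have "0 \<le> (\<integral>x. u x * p m x \<partial>M)" for m
      using p(2) by (intro Bochner_Integration.integral_nonneg) auto
    then show "0 \<le> L u"
      using tendsto_lowerbound[OF F(2)[OF u]] F(1) by (simp add: always_eventually) }
qed (rule comp)

text \<open>The Riesz theorem is only available for positive functionals, so the densities
  \<open>h m\<close> are split as \<open>(q\<^sub>1 - q\<^sub>0 / 2) + i (q\<^sub>2 - q\<^sub>0 / 2)\<close> with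
  \<open>0 \<le> q\<^sub>1, q\<^sub>2 \<le> q\<^sub>0\<close>; the domination survives in the limit and gives bounded
  Radon-Nikodym derivatives.\<close>

lemma weak_limit_exists:
  fixes M :: "'a::t2_space measure" and h :: "nat \<Rightarrow> 'a \<Rightarrow> complex"
  assumes comp: "compact (UNIV :: 'a set)" and sets: "sets M = sets borel"
    and h: "\<And>m. integrable M (h m)" "\<And>m. (\<integral>x. cmod (h m x) \<partial>M) \<le> C"
  obtains F lam k where "F \<noteq> bot" "F \<le> sequentially" "cmeas_rep lam k"
    "\<And>g. continuous_on UNIV g \<Longrightarrow> ((\<lambda>m. \<integral>x. g x * h m x \<partial>M) \<longlongrightarrow> cmeas_integral lam k g) F"
proof -
  define q :: "nat \<Rightarrow> nat \<Rightarrow> 'a \<Rightarrow> real" where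
    "q i m x = (if i = 0 then 2 * cmod (h m x) else
      if i = 1 then Re (h m x) + cmod (h m x) else Im (h m x) + cmod (h m x))" for i m x
  have q0: "0 \<le> q i m x" for i m x
    using abs_Re_le_cmod[of "h m x"] abs_Im_le_cmod[of "h m x"] by (auto simp: q_def)
  have q_le: "q i m x \<le> 2 * cmod (h m x)" for i m x
    using abs_Re_le_cmod[of "h m x"] abs_Im_le_cmod[of "h m x"] by (auto simp: q_def)
  have qi: "integrable M (q i m)" for i m
    unfolding q_def[abs_def] using h(1)[of m] by (cases "i = 0"; cases "i = 1") auto
  note iq = integrable_continuous_mult[OF comp sets _ qi]
  \<comment> \<open>An index is a pair of a component \<open>i\<close> and a test function, so that
    one filter serves all components simultaneously. The value \<open>0\<close> for discontinuous
    functions keeps every coordinate bounded.\<close>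
  define \<phi> where "\<phi> m j = (if continuous_on UNIV (snd j) then \<integral>x. snd j x * q (fst j) m x \<partial>M else 0)"
    for m j
  have "\<exists>B. \<forall>m. \<bar>\<phi> m j\<bar> \<le> B" for j
  proof (cases "continuous_on UNIV (snd j)")
    case True
    obtain B where B: "0 \<le> B" "\<And>x. norm (snd j x) \<le> B"
      using continuous_bounded_compact[OF comp True] by blast
    have "\<bar>\<phi> m j\<bar> \<le> B * (2 * C)" for m
    proof -
      have "\<bar>\<phi> m j\<bar> \<le> (\<integral>x. \<bar>snd j x * q (fst j) m x\<bar> \<partial>M)"
        using True by (simp add: \<phi>_def)
      also have "\<dots> \<le> (\<integral>x. B * (2 * cmod (h m x)) \<partial>M)"
      proof (rule integral_mono)
        show "integrable M (\<lambda>x. \<bar>snd j x * q (fst j) m x\<bar>)"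
          using iq[OF True] by (rule integrable_abs)
        show "integrable M (\<lambda>x. B * (2 * cmod (h m x)))"
          using h(1)[of m] by simp
        show "\<bar>snd j x * q (fst j) m x\<bar> \<le> B * (2 * cmod (h m x))" for x
          unfolding abs_mult using B(1) B(2)[of x] q0[of "fst j" m x] q_le[of "fst j" m x]
          by (intro mult_mono) auto
      qed
      also have "\<dots> \<le> B * (2 * C)"
        using h(2)[of m] B(1) by (simp add: mult_left_mono)
      finally show ?thesis .
    qed
    then show ?thesis by blast
  qed (auto simp: \<phi>_def)
  then obtain F l where F: "F \<noteq> bot" "F \<le> sequentially" "\<And>j. ((\<lambda>m. \<phi> m j) \<longlongrightarrow> l j) F"
    using pointwise_bounded_refine[of \<phi>] by blast
  define L where "L i u = l (i, u)" for i u
  have lim: "((\<lambda>m. \<integral>x. u x * q i m x \<partial>M) \<longlongrightarrow> L i u) F" if "continuous_on UNIV u" for i u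
    using F(3)[of "(i, u)"] that by (simp add: \<phi>_def L_def)
  have pos: "positive_functional (L i)" for i
    using positive_functional_limit[OF comp sets qi q0 F(1) lim] by blast
  let ?R = "\<lambda>i. positive_functional.riesz_measure (L i)"
  note R_frb = positive_functional.finite_regular_borel_riesz[OF pos]
  note R_fin = positive_functional.finite_riesz[OF pos]
  note R_sets = positive_functional.sets_riesz[OF pos]
  note R_rep = positive_functional.riesz_representation[OF pos]
  have L_le: "L i u \<le> L 0 u" if u: "continuous_on UNIV u" "\<And>x. 0 \<le> u x" for i u
  proof (rule tendsto_le[OF F(1) lim[OF u(1), of 0] lim[OF u(1), of i]], rule always_eventually, rule allI)
    show "(\<integral>x. u x * q i m x \<partial>M) \<le> (\<integral>x. u x * q 0 m x \<partial>M)" for m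
    proof (intro integral_mono mult_left_mono iq u)
      show "q i m x \<le> q 0 m x" for x using q_le[of i m x] by (simp add: q_def[of 0])
    qed
  qed
  have "\<exists>k. k \<in> borel_measurable borel \<and> (\<forall>x. 0 \<le> k x \<and> k x \<le> 1) \<and>
      ?R i = density (?R 0) (\<lambda>x. ennreal (k x))" for i
  proof -
    have "emeasure (?R i) E \<le> emeasure (?R 0) E" if "E \<in> sets (?R 0)" for E
      using that L_le by (intro riesz_measure_mono[OF pos pos]) (auto simp: R_sets)
    then obtain k :: "'a \<Rightarrow> real" where "k \<in> borel_measurable (?R 0)" "\<And>x. 0 \<le> k x" "\<And>x. k x \<le> 1"
      "?R i = density (?R 0) (\<lambda>x. ennreal (k x))"
      using density_bounded_exists[OF R_fin, of "?R i" 0] R_sets by metis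
    moreover have "borel_measurable (?R 0) = (borel_measurable borel :: ('a \<Rightarrow> real) set)"
      by (rule measurable_cong_sets) (simp_all add: R_sets)
    ultimately show ?thesis by blast
  qed
  then obtain k where k: "\<And>i. k i \<in> borel_measurable borel" "\<And>i x. 0 \<le> k i x" "\<And>i x. k i x \<le> 1"
      "\<And>i. ?R i = density (?R 0) (\<lambda>x. ennreal (k i x))"
    by metis
  have km: "k i \<in> borel_measurable (?R 0)" for i
    using k(1) measurable_cong_sets[OF R_sets refl] by blast
  have L_int: "(\<integral>x. u x * k i x \<partial>?R 0) = L i u" if u: "continuous_on UNIV u" for i u
  proof -
    have "L i u = (\<integral>x. u x \<partial>density (?R 0) (\<lambda>x. ennreal (k i x)))"
      unfolding k(4)[of i, symmetric] by (rule R_rep[OF u, symmetric])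
    also have "\<dots> = (\<integral>x. u x * k i x \<partial>?R 0)"
      using km k(2) borel_measurable_continuous_borel_sets[OF R_sets u]
      by (subst integral_real_density) (auto simp: mult.commute)
    finally show ?thesis ..
  qed
  \<comment> \<open>The limit of \<open>(q 1 - q 0 / 2) + \<i> * (q 2 - q 0 / 2)\<close>, written as
    a density with respect to \<open>?R 0\<close>: that measure represents the limit of
    \<open>q 0\<close>, whose half therefore becomes the constant \<open>1 / 2\<close>.\<close>
  define K where "K x = Complex (k 1 x - 1 / 2) (k 2 x - 1 / 2)" for x
  have K_bound: "cmod (K x) \<le> 2" for x
  proof -
    have "cmod (K x) \<le> \<bar>Re (K x)\<bar> + \<bar>Im (K x)\<bar>" by (rule cmod_le)
    also have "\<dots> \<le> 2" using k(2,3)[of 1 x] k(2,3)[of 2 x] by (auto simp: K_def)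
    finally show ?thesis .
  qed
  have K_meas: "K \<in> borel_measurable borel"
    unfolding K_def Complex_eq using k(1)[of 1] k(1)[of 2] by measurable
  have K_meas': "K \<in> borel_measurable (?R 0)"
    using K_meas measurable_cong_sets[OF R_sets refl] by blast
  have K_int: "integrable (?R 0) K"
    using K_meas' K_bound R_fin by (intro finite_measure.integrable_const_bound[of _ _ 2]) auto
  have "cmeas_rep (?R 0) K"
    unfolding cmeas_rep_def using R_frb K_meas K_bound by blast
  moreover have lim_real: "((\<lambda>m. \<integral>x. complex_of_real (u x) * h m x \<partial>M) \<longlongrightarrow>
      (\<integral>x. complex_of_real (u x) * K x \<partial>?R 0)) F" if u: "continuous_on UNIV u" for u
  proof -
    have uc: "continuous_on UNIV (\<lambda>x. complex_of_real (u x))"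
      using u by (intro continuous_intros)
    have eq: "(\<integral>x. complex_of_real (u x) * f x \<partial>N) = Complex (\<integral>x. u x * Re (f x) \<partial>N) (\<integral>x. u x * Im (f x) \<partial>N)"
      if "integrable N (\<lambda>x. complex_of_real (u x) * f x)" for f and N :: "'a measure"
      using integral_Re[OF that] integral_Im[OF that] by (simp add: complex_eq_iff)
    have ik: "integrable (?R 0) (\<lambda>x. u x * k i x)" for i
      using k(2,3) km R_fin by (intro integrable_continuous_mult[OF comp R_sets u]
          finite_measure.integrable_const_bound[of _ _ 1]) auto
    have i1: "integrable (?R 0) u"
      using positive_functional.integrable_riesz[OF pos u] .
    have 1: "(\<integral>x. complex_of_real (u x) * K x \<partial>?R 0) =
        Complex (L 1 u - L 0 u / 2) (L 2 u - L 0 u / 2)"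
    proof -
      have "(\<integral>x. u x * (k i x - 1 / 2) \<partial>?R 0) = L i u - L 0 u / 2" for i
        using ik[of i] i1 L_int[OF u, of i] R_rep[OF u, of 0] by (simp add: right_diff_distrib)
      then show ?thesis
        by (subst eq[OF integrable_continuous_mult[OF comp R_sets uc K_int]]) (simp add: K_def)
    qed
    have 2: "(\<integral>x. complex_of_real (u x) * h m x \<partial>M) =
        Complex ((\<integral>x. u x * q 1 m x \<partial>M) - (\<integral>x. u x * q 0 m x \<partial>M) / 2)
          ((\<integral>x. u x * q 2 m x \<partial>M) - (\<integral>x. u x * q 0 m x \<partial>M) / 2)" for m
    proof -
      have "(\<integral>x. u x * q i m x \<partial>M) - (\<integral>x. u x * q 0 m x \<partial>M) / 2 = (\<integral>x. u x * q i m x - u x * q 0 m x / 2 \<partial>M)" for i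
        using iq[OF u, of i m] iq[OF u, of 0 m] by (subst Bochner_Integration.integral_diff) auto
      note * = this
      have "u x * q 1 m x - u x * q 0 m x / 2 = u x * Re (h m x)"
          "u x * q 2 m x - u x * q 0 m x / 2 = u x * Im (h m x)" for x
        by (simp_all add: q_def algebra_simps)
      then show ?thesis
        unfolding * by (simp add: eq[OF integrable_continuous_mult[OF comp sets uc h(1)]])
    qed
    show ?thesis
      unfolding 1 2 by (intro tendsto_Complex tendsto_diff tendsto_divide tendsto_const lim u) auto
  qed
  have "((\<lambda>m. \<integral>x. g x * h m x \<partial>M) \<longlongrightarrow> cmeas_integral (?R 0) K g) F" if g: "continuous_on UNIV g" for g
  proof -
    have c: "continuous_on UNIV (\<lambda>x. Re (g x))" "continuous_on UNIV (\<lambda>x. Im (g x))"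
      using g by (auto intro!: continuous_intros)
    have eq: "(\<integral>x. g x * f x \<partial>N) = (\<integral>x. complex_of_real (Re (g x)) * f x \<partial>N)
        + \<i> * (\<integral>x. complex_of_real (Im (g x)) * f x \<partial>N)"
      if "integrable N f" "sets N = sets borel" for f and N :: "'a measure"
    proof -
      have "integrable N (\<lambda>x. complex_of_real (Re (g x)) * f x)" "integrable N (\<lambda>x. complex_of_real (Im (g x)) * f x)"
        using c by (auto intro!: integrable_continuous_mult[OF comp that(2) _ that(1)] continuous_intros)
      moreover have "g x * f x = complex_of_real (Re (g x)) * f x + \<i> * (complex_of_real (Im (g x)) * f x)" for x
        by (subst complex_eq[of "g x"]) (simp add: algebra_simps)
      ultimately show ?thesis by simp
    qed
    show ?thesis
      unfolding cmeas_integral_def eq[OF h(1) sets] eq[OF K_int R_sets]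
      by (intro tendsto_intros lim_real c)
  qed
  ultimately show ?thesis using that F by blast
qed

section \<open>Square roots in uniformly closed function algebras\<close>

text \<open>Halving the argument maps the slit plane into the open right half plane: a root on the
  imaginary axis would have a square on the closed negative half-line.\<close>

lemma Re_csqrt_pos:
  assumes "z \<noteq> 0" "\<not> (Im z = 0 \<and> Re z < 0)"
  shows "0 < Re (csqrt z)"
proof -
  obtain s where s: "s = csqrt z" "z = s\<^sup>2" using power2_csqrt[of z, symmetric] by blast
  have "0 < Re s \<or> Re s = 0" using csqrt_principal[of z] by (auto simp only: s(1))
  then have "0 < Re s" using assms unfolding s(2) by (auto simp: complex_eq_iff Re_power2 Im_power2)
  then show ?thesis by (simp only: s(1))
qed

text \<open>\<open>Im (s\<^sup>2) = 2 * Re s * Im s\<close> with \<open>Re s\<close> positive, so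
  the principal root preserves the sign of the imaginary part.\<close>

lemma csqrt_Im_mult_nonneg:
  assumes "\<not> (Im a = 0 \<and> Re a < 0)" "\<not> (Im b = 0 \<and> Re b < 0)" "0 \<le> Im a * Im b"
  shows "0 \<le> Im (csqrt a) * Im (csqrt b)"
proof (cases "a = 0 \<or> b = 0")
  case False
  obtain s t where st: "s = csqrt a" "a = s\<^sup>2" "t = csqrt b" "b = t\<^sup>2"
    using power2_csqrt[of a, symmetric] power2_csqrt[of b, symmetric] by blast
  have pos: "0 < Re s * Re t"
    unfolding st(1,3) using Re_csqrt_pos assms False by (intro mult_pos_pos) blast+
  have "Im a * Im b = 4 * (Re s * Re t) * (Im s * Im t)"
    unfolding st(2,4) by (simp add: Im_power2)
  with assms(3) pos have "0 \<le> Im s * Im t"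
    by (simp add: zero_le_mult_iff mult_less_0_iff)
  then show ?thesis by (simp only: st(1,3))
qed auto

text \<open>The quotient of the roots squares to \<open>a / b\<close>; it is the principal root once
  its real part is positive, and that real part has the sign of
  \<open>Re s * Re t + Im s * Im t\<close>. With \<open>a\<close> and \<open>b\<close> in a common
  closed half plane the second term cannot spoil the first.\<close>

lemma csqrt_divide:
  notes csqrt.simps [simp del]
  assumes "a \<noteq> 0" "b \<noteq> 0" "\<not> (Im a = 0 \<and> Re a < 0)" "\<not> (Im b = 0 \<and> Re b < 0)"
    and "0 \<le> Im a * Im b"
  shows "csqrt (a / b) = csqrt a / csqrt b"
proof (rule csqrt_unique)
  show "(csqrt a / csqrt b)\<^sup>2 = a / b" by (simp add: power_divide)
  have "0 < Re (csqrt a) * Re (csqrt b) + Im (csqrt a) * Im (csqrt b)"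
    using Re_csqrt_pos[OF assms(1,3)] Re_csqrt_pos[OF assms(2,4)] csqrt_Im_mult_nonneg[OF assms(3-5)]
    by (intro add_pos_nonneg) auto
  then have "0 < Re (csqrt a / csqrt b)"
    unfolding Re_divide using assms(2) complex_neq_0[of "csqrt b"] by (intro divide_pos_pos) auto
  then show "0 < Re (csqrt a / csqrt b) \<or> Re (csqrt a / csqrt b) = 0 \<and> 0 \<le> Im (csqrt a / csqrt b)"
    by blast
qed

text \<open>Hoelder continuity of order one half: the roots \<open>s\<close> and \<open>t\<close>
  form no obtuse angle, so \<open>cmod (s - t) \<le> cmod (s + t)\<close>, and multiplying by
  \<open>cmod (s - t)\<close> produces the difference of the squares.\<close>

lemma csqrt_diff_le:
  notes csqrt.simps [simp del]
  assumes "\<not> (Im a = 0 \<and> Re a < 0)" "\<not> (Im b = 0 \<and> Re b < 0)" "0 \<le> Im a * Im b"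
  shows "cmod (csqrt a - csqrt b) \<le> sqrt (cmod (a - b))"
proof -
  let ?s = "csqrt a" and ?t = "csqrt b"
  have "0 \<le> Re ?s * Re ?t + Im ?s * Im ?t"
    using csqrt_principal[of a] csqrt_principal[of b] csqrt_Im_mult_nonneg[OF assms] by auto
  then have "(cmod (?s - ?t))\<^sup>2 \<le> (cmod (?s + ?t))\<^sup>2"
    unfolding cmod_power2 by (simp add: power2_eq_square algebra_simps)
  then have "cmod (?s - ?t) \<le> cmod (?s + ?t)"
    by (rule power2_le_imp_le) simp
  then have "(cmod (?s - ?t))\<^sup>2 \<le> cmod ((?s - ?t) * (?s + ?t))"
    by (simp add: power2_eq_square norm_mult mult_left_mono)
  also have "(?s - ?t) * (?s + ?t) = ?s\<^sup>2 - ?t\<^sup>2"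
    by (simp add: power2_eq_square algebra_simps)
  finally show ?thesis by (intro real_le_rsqrt) simp
qed

section \<open>Functional calculus in algebras closed under uniform limits\<close>

locale function_algebra =
  fixes B :: "('a \<Rightarrow> complex) set"
  assumes const: "\<And>c. (\<lambda>x. c) \<in> B"
    and add: "\<And>f g. f \<in> B \<Longrightarrow> g \<in> B \<Longrightarrow> (\<lambda>x. f x + g x) \<in> B"
    and mult: "\<And>f g. f \<in> B \<Longrightarrow> g \<in> B \<Longrightarrow> (\<lambda>x. f x * g x) \<in> B"
    and closed: "\<And>g. (\<And>e. 0 < e \<Longrightarrow> \<exists>f\<in>B. \<forall>x. cmod (f x - g x) \<le> e) \<Longrightarrow> g \<in> B"
begin

lemma power: "f \<in> B \<Longrightarrow> (\<lambda>x. f x ^ n) \<in> B"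
  by (induction n) (simp_all add: const mult)

lemma sum: "finite I \<Longrightarrow> (\<And>i. i \<in> I \<Longrightarrow> f i \<in> B) \<Longrightarrow> (\<lambda>x. \<Sum>i\<in>I. f i x) \<in> B"
  by (induction I rule: finite_induct) (simp_all add: const add)

lemma power_series:
  assumes "f \<in> B" "\<And>x. cmod (f x) \<le> r" "summable (\<lambda>n. cmod (a n) * r ^ n)"
  shows "(\<lambda>x. \<Sum>n. a n * f x ^ n) \<in> B"
proof (rule closed)
  fix e :: real assume e: "0 < e"
  have "uniform_limit UNIV (\<lambda>n x. \<Sum>i<n. a i * f x ^ i) (\<lambda>x. \<Sum>n. a n * f x ^ n) sequentially"
    using assms(2)
    by (intro Weierstrass_m_test[OF _ assms(3)]) (auto simp: norm_mult norm_power intro!: mult_left_mono power_mono)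
  from uniform_limitD[OF this e] obtain n where
    "\<And>x. dist (\<Sum>i<n. a i * f x ^ i) (\<Sum>n. a n * f x ^ n) < e"
    by (auto simp: eventually_sequentially)
  moreover have "(\<lambda>x. \<Sum>i<n. a i * f x ^ i) \<in> B"
    by (intro sum mult const power assms) auto
  ultimately show "\<exists>g\<in>B. \<forall>x. cmod (g x - (\<Sum>n. a n * f x ^ n)) \<le> e"
    by (intro bexI[of _ "\<lambda>x. \<Sum>i<n. a i * f x ^ i"]) (auto simp: dist_norm less_imp_le)
qed

text \<open>This is the binomial series with exponent \<open>- (1 / 2)\<close>, whose sum is the
  principal power and hence the reciprocal of \<open>csqrt\<close>.\<close>

lemma inverse_csqrt_1_plus:
  assumes "w \<in> B" "\<And>x. cmod (w x) \<le> 1 / 2"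
  shows "(\<lambda>x. 1 / csqrt (1 + w x)) \<in> B"
proof -
  let ?a = "\<lambda>n. (- (1 / 2) :: complex) gchoose n"
  \<comment> \<open>Any point strictly between \<open>1 / 2\<close> and the radius of convergence
    \<open>1\<close> would do; convergence there yields absolute convergence at
    \<open>1 / 2\<close>.\<close>
  have "summable (\<lambda>n. ?a n * (3 / 4) ^ n)"
    using gen_binomial_complex[of "3/4" "- (1 / 2)"] by (simp add: sums_iff)
  then have "summable (\<lambda>n. norm (?a n * (1 / 2) ^ n))"
    by (rule powser_insidea) simp
  then have "summable (\<lambda>n. cmod (?a n) * (1 / 2) ^ n)"
    by (simp add: norm_mult norm_power norm_divide)
  from power_series[OF assms this] have "(\<lambda>x. \<Sum>n. ?a n * w x ^ n) \<in> B" .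
  moreover have "(\<Sum>n. ?a n * w x ^ n) = 1 / csqrt (1 + w x)" for x
  proof -
    have lt: "cmod (w x) < 1" using assms(2)[of x] by simp
    then have "1 + w x \<noteq> 0"
      by (metis add_eq_0_iff norm_minus_cancel norm_one less_irrefl)
    then have "(1 + w x) powr (- (1 / 2)) = 1 / csqrt (1 + w x)"
      by (simp add: csqrt_conv_powr powr_minus field_simps)
    then show ?thesis
      using gen_binomial_complex[OF lt, of "- (1 / 2)"] by (simp add: sums_iff)
  qed
  ultimately show ?thesis by simp
qed

lemma exp_closed:
  assumes "f \<in> B" "\<And>x. cmod (f x) \<le> r"
  shows "(\<lambda>x. exp (f x)) \<in> B"
proof -
  have "summable (\<lambda>n. cmod (1 / fact n) * r ^ n)"
    using summable_exp[of r] by (simp add: norm_divide field_simps)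
  from power_series[OF assms this] show ?thesis
    by (simp add: exp_def scaleR_conv_of_real field_simps)
qed

text \<open>The reciprocal root \<open>1 / csqrt (\<zeta> + d)\<close> is in the algebra for large \<open>d\<close> by the binomial
  series; re-expanding at \<open>\<zeta> + d\<close> brings \<open>d\<close> down in steps whose length only depends on the
  distance from the image of \<open>\<zeta>\<close> to the part of the slit to be crossed.\<close>

lemma inverse_csqrt_closed:
  notes csqrt.simps [simp del]
  assumes "\<zeta> \<in> B" "compact (range \<zeta>)" "\<And>x. \<not> (Im (\<zeta> x) = 0 \<and> Re (\<zeta> x) < 0)" "0 < \<delta>"
  shows "(\<lambda>x. 1 / csqrt (\<zeta> x + of_real \<delta>)) \<in> B"
proof -
  define r where "r d x = 1 / csqrt (\<zeta> x + of_real d)" for d x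
  have slit: "\<zeta> x + of_real d \<noteq> 0" "\<not> (Im (\<zeta> x + of_real d) = 0 \<and> Re (\<zeta> x + of_real d) < 0)"
    if "0 < d" for d x
    using assms(3)[of x] that by (auto simp: complex_eq_iff)
  \<comment> \<open>For \<open>d \<ge> \<delta>\<close> the zeros \<open>- of_real d\<close> of the
    shifts all lie in this closed ray. Compactness of the image gives one distance \<open>c\<close>
    for all of them.\<close>
  let ?T = "{z. Im z = 0 \<and> Re z \<le> - \<delta>}"
  have "closed ?T"
    by (intro closed_Collect_conj closed_Collect_eq closed_Collect_le continuous_intros)
  moreover have "range \<zeta> \<inter> ?T = {}"
    using assms(3,4) by force
  ultimately obtain c where c: "0 < c" "\<And>y z. y \<in> range \<zeta> \<Longrightarrow> z \<in> ?T \<Longrightarrow> c \<le> dist y z"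
    using separate_compact_closed[OF assms(2)] by meson
  have far: "c \<le> cmod (\<zeta> x + of_real d)" if "\<delta> \<le> d" for d x
    using c(2)[of "\<zeta> x" "- of_real d"] that by (simp add: dist_norm)
  have step: "r (d + e) \<in> B" if d: "r d \<in> B" "\<delta> \<le> d" "\<delta> \<le> d + e" "\<bar>e\<bar> \<le> c / 2" for d e
  proof -
    have pos: "0 < d" "0 < d + e" using d assms(4) by auto
    have r2: "(r d x)\<^sup>2 = 1 / (\<zeta> x + of_real d)" for x
      by (simp add: r_def power_divide)
    have "(\<lambda>x. 1 / csqrt (1 + of_real e * (r d x)\<^sup>2)) \<in> B"
    proof (rule inverse_csqrt_1_plus)
      show "(\<lambda>x. of_real e * (r d x)\<^sup>2) \<in> B" by (intro mult const power d)
      show "cmod (of_real e * (r d x)\<^sup>2) \<le> 1 / 2" for x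
        using far[OF d(2), of x] d(4) c(1)
        by (simp add: r2 norm_mult norm_divide divide_le_eq)
    qed
    then have "(\<lambda>x. r d x * (1 / csqrt (1 + of_real e * (r d x)\<^sup>2))) \<in> B"
      by (intro mult d)
    moreover have "r d x * (1 / csqrt (1 + of_real e * (r d x)\<^sup>2)) = r (d + e) x" for x
    proof -
      have "1 + of_real e * (r d x)\<^sup>2 = (\<zeta> x + of_real (d + e)) / (\<zeta> x + of_real d)"
        unfolding r2 using slit(1)[OF pos(1), of x] by (simp add: field_simps)
      \<comment> \<open>A real shift does not change the imaginary part, so the product of the two
        imaginary parts is a square and \<open>csqrt_divide\<close> applies.\<close>
      also have "csqrt \<dots> = csqrt (\<zeta> x + of_real (d + e)) / csqrt (\<zeta> x + of_real d)"
        using slit(1)[OF pos(1), of x] slit(1)[OF pos(2), of x]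
          slit(2)[OF pos(1), of x] slit(2)[OF pos(2), of x]
        by (intro csqrt_divide) auto
      finally show ?thesis
        using slit(1)[OF pos(1), of x] by (simp add: r_def)
    qed
    ultimately show ?thesis by (simp add: fun_eq_iff)
  qed
  obtain R where R: "\<And>x. cmod (\<zeta> x) \<le> R"
    using compact_imp_bounded[OF assms(2)] by (auto simp: bounded_iff)
  \<comment> \<open>The factor \<open>2\<close> makes \<open>\<zeta> x / D\<close> at most
    \<open>1 / 2\<close> in modulus, within reach of the binomial series.\<close>
  define D where "D = max \<delta> (2 * R)"
  have D: "0 < D" "\<delta> \<le> D" "2 * R \<le> D" using assms(4) by (auto simp: D_def)
  have start: "r D \<in> B"
  proof -
    have "(\<lambda>x. 1 / csqrt (1 + of_real (1 / D) * \<zeta> x)) \<in> B"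
    proof (rule inverse_csqrt_1_plus)
      show "(\<lambda>x. of_real (1 / D) * \<zeta> x) \<in> B" by (intro mult const assms)
      show "cmod (of_real (1 / D) * \<zeta> x) \<le> 1 / 2" for x
        using R[of x] D by (simp add: norm_mult norm_divide divide_le_eq)
    qed
    then have "(\<lambda>x. 1 / csqrt (of_real D) * (1 / csqrt (1 + of_real (1 / D) * \<zeta> x))) \<in> B"
      by (intro mult const)
    moreover have "1 / csqrt (of_real D) * (1 / csqrt (1 + of_real (1 / D) * \<zeta> x)) = r D x" for x
    proof -
      have "1 + of_real (1 / D) * \<zeta> x = (\<zeta> x + of_real D) / of_real D"
        using D by (simp add: field_simps)
      also have "csqrt \<dots> = csqrt (\<zeta> x + of_real D) / csqrt (of_real D)"
        using slit[OF D(1), of x] D by (intro csqrt_divide) auto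
      finally show ?thesis using D by (simp add: r_def)
    qed
    ultimately show ?thesis by (simp add: fun_eq_iff)
  qed
  \<comment> \<open>Steps of length at most \<open>c / 2\<close> keep
    \<open>e * (r d x)\<^sup>2\<close> within \<open>1 / 2\<close>; the \<open>max\<close> makes the
    walk land exactly on \<open>\<delta>\<close>, possibly with a shorter last step.\<close>
  have walk: "r (max \<delta> (D - real n * (c / 2))) \<in> B" for n
  proof (induction n)
    case 0
    then show ?case using start D by (simp add: max_def)
  next
    case (Suc n)
    let ?d = "max \<delta> (D - real n * (c / 2))" and ?d' = "max \<delta> (D - real (Suc n) * (c / 2))"
    have "real (Suc n) * (c / 2) = real n * (c / 2) + c / 2"
      by (simp add: algebra_simps)
    then have "\<bar>?d' - ?d\<bar> \<le> c / 2" using c(1) by linarith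
    then have "r (?d + (?d' - ?d)) \<in> B"
      by (intro step Suc) auto
    then show ?case by simp
  qed
  obtain n where "(D - \<delta>) / (c / 2) < real n" using reals_Archimedean2 by blast
  then have "max \<delta> (D - real n * (c / 2)) = \<delta>"
    using c(1) by (simp add: max_def field_simps)
  with walk[of n] show ?thesis by (simp add: r_def[abs_def])
qed

text \<open>Multiplying the reciprocal root by its radicand gives the root of the shifted function;
  as the shift tends to zero, \<open>csqrt_diff_le\<close> makes the convergence uniform, even near
  zeros of \<open>\<zeta>\<close>.\<close>

lemma csqrt_closed:
  notes csqrt.simps [simp del]
  assumes "\<zeta> \<in> B" "compact (range \<zeta>)" "\<And>x. \<not> (Im (\<zeta> x) = 0 \<and> Re (\<zeta> x) < 0)"
  shows "(\<lambda>x. csqrt (\<zeta> x)) \<in> B"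
proof (rule closed)
  fix e :: real assume e: "0 < e"
  \<comment> \<open>The Hoelder estimate bounds the error by \<open>sqrt \<delta>\<close>.\<close>
  define \<delta> where "\<delta> = e\<^sup>2"
  have \<delta>: "0 < \<delta>" using e by (simp add: \<delta>_def)
  have slit: "\<zeta> x + of_real \<delta> \<noteq> 0" "\<not> (Im (\<zeta> x + of_real \<delta>) = 0 \<and> Re (\<zeta> x + of_real \<delta>) < 0)" for x
    using assms(3)[of x] \<delta> by (auto simp: complex_eq_iff)
  have "(\<lambda>x. (\<zeta> x + of_real \<delta>) * (1 / csqrt (\<zeta> x + of_real \<delta>))) \<in> B"
    by (intro mult add const assms inverse_csqrt_closed \<delta>)
  moreover have "(\<zeta> x + of_real \<delta>) * (1 / csqrt (\<zeta> x + of_real \<delta>)) = csqrt (\<zeta> x + of_real \<delta>)" for x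
  proof -
    have "\<zeta> x + of_real \<delta> = csqrt (\<zeta> x + of_real \<delta>) * csqrt (\<zeta> x + of_real \<delta>)"
      by (simp flip: power2_eq_square)
    then show ?thesis using slit(1)[of x] by (metis (no_types) csqrt_eq_0 nonzero_mult_div_cancel_left times_divide_eq_right mult.right_neutral)
  qed
  ultimately have "(\<lambda>x. csqrt (\<zeta> x + of_real \<delta>)) \<in> B" by simp
  moreover have "cmod (csqrt (\<zeta> x + of_real \<delta>) - csqrt (\<zeta> x)) \<le> e" for x
    using csqrt_diff_le[OF slit(2)[of x] assms(3)[of x]] \<delta> e by (simp add: \<delta>_def norm_power)
  ultimately show "\<exists>f\<in>B. \<forall>x. cmod (f x - csqrt (\<zeta> x)) \<le> e"
    by (intro bexI[of _ "\<lambda>x. csqrt (\<zeta> x + of_real \<delta>)"] allI)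
qed

text \<open>\<open>cmod (exp (- s)) = exp (- Re s)\<close>, and the real part of the root is
  positive wherever \<open>\<zeta>\<close> does not vanish.\<close>

lemma peak_function:
  notes csqrt.simps [simp del]
  assumes "\<zeta> \<in> B" "compact (range \<zeta>)" "\<And>x. \<not> (Im (\<zeta> x) = 0 \<and> Re (\<zeta> x) < 0)"
  obtains h where "h \<in> B" "\<And>x. \<zeta> x = 0 \<Longrightarrow> h x = 1" "\<And>x. \<zeta> x \<noteq> 0 \<Longrightarrow> cmod (h x) < 1"
proof
  obtain R where R: "\<And>x. cmod (\<zeta> x) \<le> R"
    using compact_imp_bounded[OF assms(2)] by (auto simp: bounded_iff)
  have "(\<lambda>x. - 1 * csqrt (\<zeta> x)) \<in> B"
    by (intro mult const csqrt_closed assms)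
  then show "(\<lambda>x. exp (- csqrt (\<zeta> x))) \<in> B"
    by (intro exp_closed[of _ "sqrt R"]) (simp_all add: R)
  show "exp (- csqrt (\<zeta> x)) = 1" if "\<zeta> x = 0" for x using that by simp
  show "cmod (exp (- csqrt (\<zeta> x))) < 1" if "\<zeta> x \<noteq> 0" for x
    using Re_csqrt_pos[OF that assms(3)] by simp
qed

end

definition uniform_closure :: "('a \<Rightarrow> complex) set \<Rightarrow> ('a \<Rightarrow> complex) set" where
  "uniform_closure A = {g. \<forall>e>0. \<exists>f\<in>A. \<forall>x. cmod (f x - g x) \<le> e}"

lemma uniform_closureE:
  assumes "g \<in> uniform_closure A" "0 < e"
  obtains f where "f \<in> A" "\<And>x. cmod (f x - g x) \<le> e"
  using assms by (auto simp: uniform_closure_def)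

lemma uniform_closure_subset: "A \<subseteq> uniform_closure A"
  unfolding uniform_closure_def by (force intro: less_imp_le)

lemma function_algebra_uniform_closure:
  assumes bdd: "\<And>f. f \<in> A \<Longrightarrow> \<exists>K. \<forall>x. cmod (f x) \<le> K"
    and const: "\<And>c. (\<lambda>x. c) \<in> A"
    and add: "\<And>f g. f \<in> A \<Longrightarrow> g \<in> A \<Longrightarrow> (\<lambda>x. f x + g x) \<in> A"
    and mult: "\<And>f g. f \<in> A \<Longrightarrow> g \<in> A \<Longrightarrow> (\<lambda>x. f x * g x) \<in> A"
  shows "function_algebra (uniform_closure A)"
proof
  fix f g assume f: "f \<in> uniform_closure A" and g: "g \<in> uniform_closure A"
  show "(\<lambda>x. f x + g x) \<in> uniform_closure A"
    unfolding uniform_closure_def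
  proof safe
    fix e :: real assume "0 < e"
    then have e: "0 < e / 2" by simp
    obtain f' where f': "f' \<in> A" "\<And>x. cmod (f' x - f x) \<le> e / 2" using uniform_closureE[OF f e] by blast
    obtain g' where g': "g' \<in> A" "\<And>x. cmod (g' x - g x) \<le> e / 2" using uniform_closureE[OF g e] by blast
    have "cmod (f' x + g' x - (f x + g x)) \<le> e" for x
      using norm_triangle_mono[OF f'(2)[of x] g'(2)[of x]] by (simp add: algebra_simps)
    then show "\<exists>k\<in>A. \<forall>x. cmod (k x - (f x + g x)) \<le> e"
      using add[OF f'(1) g'(1)] by (intro bexI[of _ "\<lambda>x. f' x + g' x"] allI)
  qed
  have bounded: "\<exists>K\<ge>0. \<forall>x. cmod (k x) \<le> K" if k: "k \<in> uniform_closure A" for k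
  proof -
    obtain k' where k': "k' \<in> A" "\<And>x. cmod (k' x - k x) \<le> 1" using uniform_closureE[OF k zero_less_one] by blast
    obtain K where K: "\<And>x. cmod (k' x) \<le> K" using bdd[OF k'(1)] by blast
    have le: "cmod (k x) \<le> K + 1" for x
      using norm_triangle_sub[of "k x" "k' x"] K[of x] k'(2)[of x] by (simp add: norm_minus_commute)
    moreover have "0 \<le> K + 1" using le[of undefined] norm_ge_zero order_trans by blast
    ultimately show ?thesis by blast
  qed
  show "(\<lambda>x. f x * g x) \<in> uniform_closure A"
    unfolding uniform_closure_def
  proof safe
    fix e :: real assume e: "0 < e"
    obtain K L where K: "0 \<le> K" "\<And>x. cmod (f x) \<le> K" and L: "0 \<le> L" "\<And>x. cmod (g x) \<le> L"
      using bounded[OF f] bounded[OF g] by blast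
    \<comment> \<open>The error of the product has three terms. The bound
      \<open>\<eta> \<le> 1\<close> makes the quadratic one linear, so that together they are at
      most \<open>\<eta> * (K + L + 1)\<close>.\<close>
    define \<eta> where "\<eta> = min 1 (e / (K + L + 1))"
    have \<eta>: "0 < \<eta>" "\<eta> \<le> 1" using e K(1) L(1) by (auto simp: \<eta>_def)
    have "\<eta> \<le> e / (K + L + 1)" by (simp add: \<eta>_def)
    then have \<eta>e: "\<eta> * (K + L + 1) \<le> e" using K(1) L(1) by (simp add: pos_le_divide_eq)
    obtain f' where f': "f' \<in> A" "\<And>x. cmod (f' x - f x) \<le> \<eta>" using uniform_closureE[OF f \<eta>(1)] by blast
    obtain g' where g': "g' \<in> A" "\<And>x. cmod (g' x - g x) \<le> \<eta>" using uniform_closureE[OF g \<eta>(1)] by blast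
    have "cmod (f' x * g' x - f x * g x) \<le> e" for x
    proof -
      have "f' x * g' x - f x * g x = (f' x - f x) * (g' x - g x) + (f' x - f x) * g x + f x * (g' x - g x)"
        by (simp add: algebra_simps)
      also have "cmod \<dots> \<le> \<eta> * 1 + \<eta> * L + K * \<eta>"
        unfolding norm_mult[symmetric]
        by (intro norm_triangle_mono; simp only: norm_mult;
            intro mult_mono f' g' K L order_trans[OF g'(2) \<eta>(2)]; (simp add: K L less_imp_le[OF \<eta>(1)])?)
      also have "\<dots> \<le> e" using \<eta>e by (simp add: algebra_simps)
      finally show ?thesis .
    qed
    then show "\<exists>k\<in>A. \<forall>x. cmod (k x - f x * g x) \<le> e"
      using mult[OF f'(1) g'(1)] by (intro bexI[of _ "\<lambda>x. f' x * g' x"] allI)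
  qed
next
  fix c :: complex
  show "(\<lambda>x. c) \<in> uniform_closure A" using uniform_closure_subset const by blast
next
  fix g assume g: "\<And>e. 0 < e \<Longrightarrow> \<exists>f\<in>uniform_closure A. \<forall>x. cmod (f x - g x) \<le> e"
  show "g \<in> uniform_closure A"
    unfolding uniform_closure_def
  proof safe
    fix e :: real assume "0 < e"
    then have e: "0 < e / 2" by simp
    obtain f where f: "f \<in> uniform_closure A" "\<And>x. cmod (f x - g x) \<le> e / 2" using g[OF e] by blast
    obtain f' where f': "f' \<in> A" "\<And>x. cmod (f' x - f x) \<le> e / 2" using uniform_closureE[OF f(1) e] by blast
    have "cmod (f' x - g x) \<le> e" for x
      using norm_triangle_mono[OF f'(2)[of x] f(2)[of x]] by simp
    then show "\<exists>f\<in>A. \<forall>x. cmod (f x - g x) \<le> e"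
      using f'(1) by (intro bexI[of _ f'] allI)
  qed
qed

section \<open>Peak sets\<close>

lemma finite_regular_borelD:
  assumes "finite_regular_borel M"
  shows "sets M = sets borel" "space M = UNIV" "finite_measure M"
proof -
  show s: "sets M = sets borel" using assms by (simp add: finite_regular_borel_def borel_on_def)
  show "space M = UNIV" using sets_eq_imp_space_eq[OF s] by simp
  then show "finite_measure M"
    using assms by (intro finite_measureI) (auto simp: finite_regular_borel_def)
qed

lemma L2_integrable:
  assumes "finite_measure M" "f \<in> L2 M"
  shows "integrable M f"
proof -
  interpret finite_measure M by fact
  have f: "f \<in> borel_measurable M" "integrable M (\<lambda>x. (cmod (f x))\<^sup>2)"
    using assms(2) by (auto simp: L2_def)
  show ?thesis
  proof (rule Bochner_Integration.integrable_bound[of M "\<lambda>x. 1 + (cmod (f x))\<^sup>2"])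
    show "integrable M (\<lambda>x. 1 + (cmod (f x))\<^sup>2)" using f(2) by simp
    have "t \<le> 1 + t\<^sup>2" for t :: real
      using zero_le_power2[of "t - 1 / 2"] by (simp add: power2_eq_square algebra_simps)
    then show "AE x in M. cmod (f x) \<le> norm (1 + (cmod (f x))\<^sup>2)" by simp
  qed (use f in simp)
qed

lemma bounded_in_L2:
  assumes "finite_measure M" "f \<in> borel_measurable M" "\<And>x. cmod (f x) \<le> B"
  shows "f \<in> L2 M"
proof -
  interpret finite_measure M by fact
  have "integrable M (\<lambda>x. (cmod (f x))\<^sup>2)"
    using assms(2) power_mono[OF assms(3) norm_ge_zero, of _ 2]
    by (intro integrable_const_bound[of _ "B\<^sup>2"]) auto
  then show ?thesis using assms(2) by (simp add: L2_def)
qed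

lemma continuous_in_L2:
  fixes f :: "'a::topological_space \<Rightarrow> complex"
  assumes "compact (UNIV :: 'a set)" "finite_regular_borel M" "continuous_on UNIV f"
  shows "f \<in> L2 M"
proof -
  obtain B where "\<And>x. cmod (f x) \<le> B" using continuous_bounded_compact[OF assms(1,3)] by blast
  with finite_regular_borelD(1,3)[OF assms(2)] borel_measurable_continuous_borel_sets[OF _ assms(3)]
  show ?thesis by (intro bounded_in_L2)
qed

lemma continuous_uniform_closure:
  assumes "\<And>f. f \<in> A \<Longrightarrow> continuous_on UNIV f" "g \<in> uniform_closure A"
  shows "continuous_on UNIV (g :: 'a::topological_space \<Rightarrow> complex)"
proof -
  have "\<exists>f\<in>A. \<forall>x. cmod (f x - g x) \<le> 1 / real (Suc n)" for n
    using assms(2) by (simp add: uniform_closure_def)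
  then obtain f where f: "\<And>n. f n \<in> A" "\<And>n x. cmod (f n x - g x) \<le> 1 / real (Suc n)"
    by metis
  have "uniform_limit UNIV f g sequentially"
  proof (rule uniform_limitI)
    fix e :: real assume "0 < e"
    then have "\<forall>\<^sub>F n in sequentially. 1 / real (Suc n) < e"
      using order_tendstoD(2)[OF LIMSEQ_inverse_real_of_nat] by (simp add: inverse_eq_divide)
    then show "\<forall>\<^sub>F n in sequentially. \<forall>x\<in>UNIV. dist (f n x) (g x) < e"
      by eventually_elim (simp add: dist_norm le_less_trans[OF f(2)])
  qed
  then show ?thesis
    using f(1) assms(1) by (intro uniform_limit_theorem[of UNIV f sequentially]) auto
qed

text \<open>The L2 norm is at most the sup norm times \<open>sqrt (measure M UNIV)\<close>, and
  \<open>H\<close> is closed in L2. This makes functions obtained from \<open>A\<close> by uniform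
  limits available for orthogonality.\<close>

lemma uniform_closure_in_closed_subspace:
  fixes M :: "'a::topological_space measure"
  assumes "compact (UNIV :: 'a set)" "finite_regular_borel M" "closed_L2_subspace M H"
    and A: "A \<subseteq> {f. continuous_on UNIV f} \<inter> H"
  shows "uniform_closure A \<subseteq> H"
proof
  fix g assume g: "g \<in> uniform_closure A"
  interpret finite_measure M using finite_regular_borelD[OF assms(2)] by blast
  have cg: "continuous_on UNIV g" using continuous_uniform_closure[OF _ g] A by auto
  have "\<exists>f\<in>A. \<forall>x. cmod (f x - g x) \<le> 1 / real (Suc n)" for n
    using g by (simp add: uniform_closure_def)
  then obtain f where f: "\<And>n. f n \<in> A" "\<And>n x. cmod (f n x - g x) \<le> 1 / real (Suc n)"
    by metis
  define K where "K = sqrt (measure M UNIV)"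
  have le: "L2_norm M (\<lambda>x. f n x - g x) \<le> 1 / real (Suc n) * K" for n
  proof -
    have c: "continuous_on UNIV (\<lambda>x. f n x - g x)"
      using f(1)[of n] A cg by (auto intro!: continuous_intros)
    have "(\<integral>x. (cmod (f n x - g x))\<^sup>2 \<partial>M) \<le> (\<integral>x. (1 / real (Suc n))\<^sup>2 \<partial>M)"
    proof (rule integral_mono)
      show "integrable M (\<lambda>x. (cmod (f n x - g x))\<^sup>2)"
        using continuous_in_L2[OF assms(1,2) c] by (simp add: L2_def)
      show "(cmod (f n x - g x))\<^sup>2 \<le> (1 / real (Suc n))\<^sup>2" for x
        using f(2) by (rule power_mono) simp
    qed simp
    also have "\<dots> = (1 / real (Suc n))\<^sup>2 * measure M UNIV"
      using finite_regular_borelD(2)[OF assms(2)] by simp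
    finally have "L2_norm M (\<lambda>x. f n x - g x) \<le> sqrt ((1 / real (Suc n))\<^sup>2 * measure M UNIV)"
      unfolding L2_norm_def by (rule real_sqrt_le_mono)
    then show ?thesis by (simp add: real_sqrt_mult K_def)
  qed
  have nonneg: "0 \<le> L2_norm M (\<lambda>x. f n x - g x)" for n
    by (simp add: L2_norm_def)
  have "(\<lambda>n. 1 / real (Suc n) * K) \<longlonglongrightarrow> 0"
    using tendsto_mult_left_zero[OF LIMSEQ_inverse_real_of_nat, of K] by (simp add: inverse_eq_divide)
  then have "(\<lambda>n. L2_norm M (\<lambda>x. f n x - g x)) \<longlonglongrightarrow> 0"
    by (rule Lim_null_comparison[rotated], unfold real_norm_def abs_of_nonneg[OF nonneg])
       (intro always_eventually allI le)
  moreover have "\<forall>n. f n \<in> H" using f(1) A by blast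
  moreover have "\<forall>h g. (\<forall>n. h n \<in> H) \<and> g \<in> L2 M \<and>
      (\<lambda>n. L2_norm M (\<lambda>x. h n x - g x)) \<longlonglongrightarrow> 0 \<longrightarrow> g \<in> H"
    using assms(3) unfolding closed_L2_subspace_def by (elim conjE)
  ultimately show "g \<in> H"
    using continuous_in_L2[OF assms(1,2) cg] by blast
qed

text \<open>If \<open>h\<close> peaks on \<open>E\<close>, project normalised indicators of shrinking neighbourhoods of \<open>E\<close>.
  A weak-* limit \<open>k d\<lambda>\<close> of the projections integrates every \<open>cnj (h ^ n)\<close> to \<open>1\<close>, so it
  gives \<open>E\<close> mass \<open>1\<close>.\<close>

lemma peak_set_not_null:
  fixes M :: "'a::t2_space measure" and h :: "'a \<Rightarrow> complex"
  assumes comp: "compact (UNIV :: 'a set)" and mu: "finite_regular_borel M" "full_support M"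
    and H: "closed_L2_subspace M H" and P: "is_orth_proj M H P"
    and ii: "\<And>lam k. cmeas_rep lam k \<Longrightarrow> in_wstar_closure M H lam k \<Longrightarrow> cmeas_abs_cont M lam k"
    and C: "\<And>f. f \<in> L2 M \<Longrightarrow> L1_norm M (P f) \<le> C * L1_norm M f"
    and h: "continuous_on UNIV h" "\<And>n. (\<lambda>x. h x ^ n) \<in> H"
    and peak: "\<And>x. x \<in> E \<Longrightarrow> h x = 1" "\<And>x. x \<notin> E \<Longrightarrow> cmod (h x) < 1" and ne: "E \<noteq> {}"
  shows "emeasure M E \<noteq> 0"
proof -
  note M = finite_regular_borelD[OF mu(1)]
  interpret finite_measure M by (rule M(3))
  have h_le: "cmod (h x) \<le> 1" for x using peak[of x] by (cases "x \<in> E") auto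
  have E_eq: "E = {x. h x = 1}" using peak by force
  have "closed E" unfolding E_eq using h(1) by (intro closed_Collect_eq continuous_intros)
  then have E: "E \<in> sets borel" by simp
  \<comment> \<open>Neighbourhoods cut out by \<open>h\<close> itself, so that \<open>h ^ n\<close>
    differs from \<open>1\<close> by at most \<open>n / (m + 1)\<close> on
    \<open>V m\<close>.\<close>
  define V where "V m = {x. cmod (h x - 1) < 1 / real (Suc m)}" for m
  have oV: "open (V m)" for m
    unfolding V_def using h(1) by (intro open_Collect_less continuous_intros)
  then have sV: "V m \<in> sets M" for m by (simp add: M)
  have "E \<subseteq> V m" for m using peak(1) by (auto simp: V_def)
  \<comment> \<open>\<open>E\<close> itself might be null, but its open neighbourhoods are not; this
    permits the normalisation.\<close>
  then have "emeasure M (V m) > 0" for m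
    using mu(2) oV ne unfolding full_support_def by blast
  then have Vpos: "0 < measure M (V m)" for m by (simp add: emeasure_eq_measure)
  define f where "f m x = complex_of_real (indicator (V m) x / measure M (V m))" for m x
  have f_meas: "f m \<in> borel_measurable M" for m
    unfolding f_def[abs_def] using sV[of m] by measurable
  have f_norm: "cmod (f m x) = indicator (V m) x / measure M (V m)" for m x
    by (simp add: f_def norm_divide indicator_def)
  have f_int: "integrable M (f m)" and f_L2: "f m \<in> L2 M" for m
  proof -
    have "cmod (f m x) \<le> 1 / measure M (V m)" for x
      by (simp add: f_norm indicator_def)
    then show "f m \<in> L2 M" by (intro bounded_in_L2 M f_meas)
    then show "integrable M (f m)" by (rule L2_integrable[OF M(3)])
  qed
  have f_L1: "(\<integral>x. cmod (f m x) \<partial>M) = 1" for m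
    unfolding f_norm using sV Vpos[of m] by (simp add: M(2))
  have PH: "P (f m) \<in> H" for m using P f_L2 by (simp add: is_orth_proj_def)
  have "H \<subseteq> L2 M" using H unfolding closed_L2_subspace_def by (elim conjE)
  then have PL2: "P (f m) \<in> L2 M" for m using PH by blast
  have P_int: "integrable M (P (f m))" for m by (rule L2_integrable[OF M(3) PL2])
  have P_L1: "(\<integral>x. cmod (P (f m) x) \<partial>M) \<le> C" for m
    using C[OF f_L2[of m]] f_L1 by (simp add: L1_norm_def)
  obtain F lam k where F: "F \<noteq> bot" "F \<le> sequentially" and rep: "cmeas_rep lam k"
    and lim: "\<And>g. continuous_on UNIV g \<Longrightarrow>
      ((\<lambda>m. \<integral>x. g x * P (f m) x \<partial>M) \<longlongrightarrow> cmeas_integral lam k g) F"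
    by (rule weak_limit_exists[OF comp M(1), of "\<lambda>m. P (f m)" C, OF P_int P_L1]) blast
  \<comment> \<open>Each \<open>P (f m)\<close> lies in \<open>H\<close>, and finitely many test
    functions converge simultaneously along the proper filter, so a single index \<open>m\<close>
    serves all of them.\<close>
  have "in_wstar_closure M H lam k"
    unfolding in_wstar_closure_def
  proof (intro allI impI, elim conjE)
    fix G :: "('a \<Rightarrow> complex) set" and e :: real
    assume G: "finite G" "\<forall>g\<in>G. continuous_on UNIV g" "0 < e"
    have "\<forall>\<^sub>F m in F. \<forall>g\<in>G. cmod (cmeas_integral lam k g - (\<integral>x. g x * P (f m) x \<partial>M)) < e"
    proof (rule eventually_ball_finite[OF G(1)], rule ballI)
      fix g assume "g \<in> G"
      then show "\<forall>\<^sub>F m in F. cmod (cmeas_integral lam k g - (\<integral>x. g x * P (f m) x \<partial>M)) < e"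
        using tendstoD[OF lim G(3), of g] G(2) by (auto simp: dist_norm norm_minus_commute)
    qed
    then obtain m where "\<forall>g\<in>G. cmod (cmeas_integral lam k g - (\<integral>x. g x * P (f m) x \<partial>M)) < e"
      using eventually_happens' F(1) by blast
    then show "\<exists>h\<in>H. \<forall>g\<in>G. cmod (cmeas_integral lam k g - (\<integral>x. g x * h x \<partial>M)) < e"
      using PH by blast
  qed
  with ii rep have ac: "cmeas_abs_cont M lam k" by blast
  have one: "cmeas_integral lam k (\<lambda>x. cnj (h x ^ n)) = 1" for n
  proof -
    have c: "continuous_on UNIV (\<lambda>x. cnj (h x ^ n))"
      using h(1) by (intro continuous_intros)
    note int = integrable_continuous_mult[OF comp M(1) c]
    have bound: "cmod ((\<integral>x. cnj (h x ^ n) * P (f m) x \<partial>M) - 1) \<le> real n * (1 / real (Suc m))" for m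
    proof -
      \<comment> \<open>Orthogonality to \<open>h ^ n\<close> replaces \<open>P (f m)\<close> by
        \<open>f m\<close>, which has integral \<open>1\<close> and lives where \<open>h\<close> is
        close to \<open>1\<close>.\<close>
      have "L2_inner M (\<lambda>x. f m x - P (f m) x) (\<lambda>x. h x ^ n) = 0"
        using P f_L2 h(2) by (simp add: is_orth_proj_def)
      then have "(\<integral>x. cnj (h x ^ n) * f m x - cnj (h x ^ n) * P (f m) x \<partial>M) = 0"
        by (simp add: L2_inner_def algebra_simps)
      then have "(\<integral>x. cnj (h x ^ n) * P (f m) x \<partial>M) = (\<integral>x. cnj (h x ^ n) * f m x \<partial>M)"
        using int[OF f_int[of m]] int[OF P_int[of m]] by simp
      moreover have "(\<integral>x. f m x \<partial>M) = 1"
      proof -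
        have "f m x = of_real (cmod (f m x))" for x unfolding f_norm by (simp add: f_def)
        then have "(\<integral>x. f m x \<partial>M) = (\<integral>x. of_real (cmod (f m x)) \<partial>M)"
          by (intro Bochner_Integration.integral_cong refl)
        also have "\<dots> = 1" using f_L1[of m] by (simp only: integral_complex_of_real of_real_1)
        finally show ?thesis .
      qed
      ultimately have "(\<integral>x. cnj (h x ^ n) * P (f m) x \<partial>M) - 1 = (\<integral>x. cnj (h x ^ n) * f m x - f m x \<partial>M)"
        using int[OF f_int[of m]] f_int[of m] by simp
      also have "cmod \<dots> \<le> (\<integral>x. cmod (cnj (h x ^ n) * f m x - f m x) \<partial>M)"
        by (rule integral_norm_bound)
      also have "\<dots> \<le> (\<integral>x. real n * (1 / real (Suc m)) * cmod (f m x) \<partial>M)"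
      proof (rule integral_mono)
        show "integrable M (\<lambda>x. cmod (cnj (h x ^ n) * f m x - f m x))"
          using int[OF f_int[of m]] f_int[of m] by simp
        show "integrable M (\<lambda>x. real n * (1 / real (Suc m)) * cmod (f m x))"
          using f_int[of m] by simp
        fix x
        have "cmod (cnj (h x ^ n) * f m x - f m x) = cmod (h x ^ n - 1 ^ n) * cmod (f m x)"
        proof -
          have "cnj (h x ^ n) * f m x - f m x = cnj (h x ^ n - 1 ^ n) * f m x"
            by (simp add: algebra_simps)
          then show ?thesis by (simp only: norm_mult complex_mod_cnj)
        qed
        also have "\<dots> \<le> real n * (1 / real (Suc m)) * cmod (f m x)"
        proof (cases "x \<in> V m")
          case True
          have "cmod (h x ^ n - 1 ^ n) \<le> real n * cmod (h x - 1)"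
            using h_le[of x] by (intro norm_power_diff) auto
          also have "\<dots> \<le> real n * (1 / real (Suc m))"
            using True by (intro mult_left_mono) (auto simp: V_def)
          finally show ?thesis by (rule mult_right_mono) simp
        next
          case False
          then show ?thesis by (simp add: f_norm)
        qed
        finally show "cmod (cnj (h x ^ n) * f m x - f m x) \<le> real n * (1 / real (Suc m)) * cmod (f m x)" .
      qed
      also have "\<dots> = real n * (1 / real (Suc m))" using f_L1[of m] by simp
      finally show ?thesis .
    qed
    have "(\<lambda>m. real n * (1 / real (Suc m))) \<longlonglongrightarrow> 0"
      using tendsto_mult_right_zero[OF LIMSEQ_inverse_real_of_nat, of "real n"] by (simp add: inverse_eq_divide)
    then have "(\<lambda>m. (\<integral>x. cnj (h x ^ n) * P (f m) x \<partial>M) - 1) \<longlonglongrightarrow> 0"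
      by (rule Lim_null_comparison[OF always_eventually[OF allI[OF bound]]])
    then have "((\<lambda>m. \<integral>x. cnj (h x ^ n) * P (f m) x \<partial>M) \<longlongrightarrow> 1) sequentially"
      by (rule LIM_zero_cancel)
    then have "((\<lambda>m. \<integral>x. cnj (h x ^ n) * P (f m) x \<partial>M) \<longlongrightarrow> 1) F"
      by (rule tendsto_mono[OF F(2)])
    then show ?thesis by (rule tendsto_unique[OF F(1) lim[OF c]])
  qed
  have lamM: "finite_regular_borel lam" and km: "k \<in> borel_measurable borel"
    using rep unfolding cmeas_rep_def by blast+
  obtain B where B: "\<And>x. cmod (k x) \<le> B" using rep unfolding cmeas_rep_def by blast
  note lam = finite_regular_borelD[OF lamM]
  interpret lam: finite_measure lam by (rule lam(3))
  have km': "k \<in> borel_measurable lam" using km measurable_cong_sets[OF lam(1) refl] by blast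
  have hm': "h \<in> borel_measurable lam" using borel_measurable_continuous_borel_sets[OF lam(1) h(1)] .
  \<comment> \<open>Because \<open>h\<close> peaks on \<open>E\<close>, the conjugated powers
    converge boundedly and pointwise to the indicator of \<open>E\<close>.\<close>
  have "(\<lambda>n. \<integral>x. cnj (h x ^ n) * k x \<partial>lam) \<longlonglongrightarrow> (\<integral>x. indicator E x * k x \<partial>lam)"
  proof (rule integral_dominated_convergence[where w="\<lambda>x. B"])
    show "(\<lambda>x. indicator E x * k x) \<in> borel_measurable lam"
      using km' E lam(1) by measurable
    show "(\<lambda>x. cnj (h x ^ n) * k x) \<in> borel_measurable lam" for n
      using km' hm' by (intro borel_measurable_times borel_measurable_continuous_on[of cnj] borel_measurable_power)
        (auto intro!: continuous_intros)
    show "AE x in lam. (\<lambda>n. cnj (h x ^ n) * k x) \<longlonglongrightarrow> indicator E x * k x"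
    proof (rule AE_I2)
      fix x
      show "(\<lambda>n. cnj (h x ^ n) * k x) \<longlonglongrightarrow> indicator E x * k x"
      proof (cases "x \<in> E")
        case True
        then show ?thesis using peak(1) by simp
      next
        case False
        have "(\<lambda>n. cnj (h x) ^ n * k x) \<longlonglongrightarrow> 0 * k x"
          using peak(2)[OF False] by (intro tendsto_intros LIMSEQ_power_zero) simp
        then show ?thesis using False by simp
      qed
    qed
    show "AE x in lam. norm (cnj (h x ^ n) * k x) \<le> B" for n
    proof (rule AE_I2)
      fix x
      have "norm (cnj (h x ^ n) * k x) = cmod (h x) ^ n * cmod (k x)"
        by (simp only: norm_mult complex_mod_cnj norm_power)
      also have "\<dots> \<le> 1 * B"
        using h_le[of x] B[of x] by (intro mult_mono power_le_one) auto
      finally show "norm (cnj (h x ^ n) * k x) \<le> B" by simp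
    qed
  qed simp
  moreover have "(\<integral>x. cnj (h x ^ n) * k x \<partial>lam) = 1" for n
    using one[of n] by (simp add: cmeas_integral_def)
  ultimately have "(\<lambda>n::nat. 1) \<longlonglongrightarrow> cmeas_val lam k E"
    unfolding cmeas_val_def by (simp only:)
  then have "cmeas_val lam k E = 1"
    by (simp add: LIMSEQ_const_iff)
  moreover have "cmeas_val lam k E = 0" if "emeasure M E = 0"
    using ac E that unfolding cmeas_abs_cont_def by blast
  ultimately show ?thesis by (metis zero_neq_one)
qed

theorem theorem3p1:
  fixes M :: "'a::t2_space measure"
    and H :: "('a \<Rightarrow> complex) set"
    and P :: "('a \<Rightarrow> complex) \<Rightarrow> ('a \<Rightarrow> complex)"
    and A :: "('a \<Rightarrow> complex) set"
  assumes X_compact: "compact (UNIV :: 'a set)"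
    and X_connected: "connected (UNIV :: 'a set)"
    and mu: "finite_regular_borel M"
    and mu_supp: "full_support M"
    and H: "closed_L2_subspace M H"
    and P: "is_orth_proj M H P"
    and A_sub: "A \<subseteq> {f. continuous_on UNIV f} \<inter> H"
    and A_add: "\<forall>f\<in>A. \<forall>g\<in>A. (\<lambda>x. f x + g x) \<in> A"
    and A_scal: "\<forall>c. \<forall>f\<in>A. (\<lambda>x. c * f x) \<in> A"
    and A_const: "\<forall>c. (\<lambda>x. c) \<in> A"
    and A_mult: "\<forall>f\<in>A. \<forall>g\<in>A. (\<lambda>x. f x * g x) \<in> A"
    and i: "\<exists>f0\<in>A. \<not> (\<exists>c. \<forall>x. f0 x = c)"
    and ii: "\<forall>lam k. cmeas_rep lam k \<and> in_wstar_closure M H lam k \<longrightarrow> cmeas_abs_cont M lam k"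
  shows "\<not> (\<exists>C. \<forall>f\<in>L2 M. L1_norm M (P f) \<le> C * L1_norm M f)"
proof
  assume "\<exists>C. \<forall>f\<in>L2 M. L1_norm M (P f) \<le> C * L1_norm M f"
  then obtain C where C: "\<And>f. f \<in> L2 M \<Longrightarrow> L1_norm M (P f) \<le> C * L1_norm M f" by blast
  note M = finite_regular_borelD[OF mu]
  interpret M: finite_measure M by (rule M(3))
  have A_cont: "continuous_on UNIV f" if "f \<in> A" for f using A_sub that by blast
  define B where "B = uniform_closure A"
  interpret B: function_algebra B
    unfolding B_def
  proof (rule function_algebra_uniform_closure)
    show "\<exists>K. \<forall>x. cmod (f x) \<le> K" if "f \<in> A" for f
      using continuous_bounded_compact[OF X_compact A_cont[OF that]] by blast
  qed (use A_const A_add A_mult in blast)+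
  have B_cont: "continuous_on UNIV f" if "f \<in> B" for f
    using continuous_uniform_closure[OF A_cont] that unfolding B_def by blast
  have B_H: "B \<subseteq> H"
    unfolding B_def by (rule uniform_closure_in_closed_subspace[OF X_compact mu H A_sub])
  have "\<exists>f\<in>A. \<exists>x y. Re (f x) < Re (f y)"
  proof -
    obtain f0 where f0: "f0 \<in> A" "\<not> (\<exists>c. \<forall>x. f0 x = c)" using i by blast
    then obtain x y where xy: "f0 x \<noteq> f0 y" by blast
    show ?thesis
    proof (cases "Re (f0 x) = Re (f0 y)")
      case False
      then show ?thesis using f0(1) by (metis linorder_less_linear)
    next
      case True
      with xy have "Im (f0 x) \<noteq> Im (f0 y)" by (simp add: complex_eq_iff)
      \<comment> \<open>Rotation by \<open>- \<i>\<close> makes the imaginary part of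
        \<open>f0\<close> the real part of the new function.\<close>
      moreover have "(\<lambda>x. - \<i> * f0 x) \<in> A" using A_scal f0(1) by blast
      ultimately show ?thesis
        by (intro bexI[of _ "\<lambda>x. - \<i> * f0 x"]) (auto, metis linorder_less_linear)
    qed
  qed
  then obtain f p q where f: "f \<in> A" and pq: "Re (f p) < Re (f q)" by blast
  have f_cont: "continuous_on UNIV f" by (rule A_cont[OF f])
  have Re_cont: "continuous_on UNIV (\<lambda>x. Re (f x))" using f_cont by (intro continuous_intros)
  have Im_cont: "continuous_on UNIV (\<lambda>x. Im (f x))" using f_cont by (intro continuous_intros)
  \<comment> \<open>Each such level set contains a peak set, hence is not null.\<close>
  have pos: "measure M {x. Re (f x) = t} \<noteq> 0" if t: "t \<in> {Re (f p)..Re (f q)}" for t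
  proof -
    let ?S = "{x. Re (f x) = t}"
    have "connected (range (\<lambda>x. Re (f x)))"
      by (rule connected_continuous_image[OF Re_cont X_connected])
    then have "t \<in> range (\<lambda>x. Re (f x))"
      using t connected_contains_Icc[of _ "Re (f p)" "Re (f q)"] by blast
    then have "?S \<noteq> {}" by auto
    moreover have closed: "closed ?S" using f_cont by (intro closed_Collect_eq continuous_intros)
    then have "compact ?S" using compact_Int_closed[OF X_compact] by fastforce
    ultimately obtain s where s: "Re (f s) = t" "\<And>x. Re (f x) = t \<Longrightarrow> Im (f s) \<le> Im (f x)"
      using continuous_attains_inf[of ?S "\<lambda>x. Im (f x)"] continuous_on_subset[OF Im_cont subset_UNIV] by auto
    \<comment> \<open>Translation moves the lowest value \<open>f s\<close> to \<open>0\<close>, and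
      the factor \<open>- \<i>\<close> turns the downward ray into the negative real axis, the cut
      of \<open>csqrt\<close>. A value of \<open>\<zeta>\<close> on the cut would give a point of
      the level set lying below \<open>f s\<close>.\<close>
    define \<zeta> where "\<zeta> x = - \<i> * (f x + - f s)" for x
    have \<zeta>: "\<zeta> \<in> B"
      unfolding \<zeta>_def[abs_def] using f uniform_closure_subset[of A]
      by (intro B.mult B.add B.const) (auto simp: B_def)
    have \<zeta>0: "\<zeta> x = 0 \<longleftrightarrow> f x = f s" for x by (simp add: \<zeta>_def)
    have "compact (range \<zeta>)"
      by (rule compact_continuous_image[OF B_cont[OF \<zeta>] X_compact])
    moreover have "\<not> (Im (\<zeta> x) = 0 \<and> Re (\<zeta> x) < 0)" for x
      using s(1) s(2)[of x] by (auto simp: \<zeta>_def)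
    ultimately obtain h where h: "h \<in> B" "\<And>x. \<zeta> x = 0 \<Longrightarrow> h x = 1"
        "\<And>x. \<zeta> x \<noteq> 0 \<Longrightarrow> cmod (h x) < 1"
      using B.peak_function[OF \<zeta>] by blast
    have E: "emeasure M {x. f x = f s} \<noteq> 0"
    proof (rule peak_set_not_null[OF X_compact mu mu_supp H P _ C])
      show "cmeas_abs_cont M lam k" if "cmeas_rep lam k" "in_wstar_closure M H lam k" for lam k
        using ii that by blast
      show "continuous_on UNIV h" by (rule B_cont[OF h(1)])
      show "(\<lambda>x. h x ^ n) \<in> H" for n using B.power[OF h(1)] B_H by blast
    qed (use h(2,3) \<zeta>0 in auto)
    have "emeasure M {x. f x = f s} \<le> emeasure M ?S"
      using closed s(1) by (intro emeasure_mono) (auto simp: M)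
    with E show ?thesis by (auto simp: M.emeasure_eq_measure measure_le_0_iff)
  qed
  have meas: "(\<lambda>x. Re (f x)) \<in> measurable M borel"
    by (rule borel_measurable_continuous_borel_sets[OF M(1) Re_cont])
  \<comment> \<open>Under the distribution of \<open>Re f\<close> the level sets become single
    points, and a finite measure charges at most countably many of them.\<close>
  interpret N: finite_measure "distr M borel (\<lambda>x. Re (f x))"
    using meas by (rule M.finite_measure_distr)
  have "measure (distr M borel (\<lambda>x. Re (f x))) {t} = measure M {x. Re (f x) = t}" for t
    using meas by (simp add: measure_distr M(2) vimage_def)
  with pos have "{Re (f p)..Re (f q)} \<subseteq> {t. measure (distr M borel (\<lambda>x. Re (f x))) {t} \<noteq> 0}" by auto
  then have "countable {Re (f p)..Re (f q)}"
    using N.countable_support countable_subset by blast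
  then show False using uncountable_closed_interval[of "Re (f p)" "Re (f q)"] pq by simp
qed

end
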